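(* Let $\mathcal{U}$ be a finite set, $p(y\mid u)$ a kernel, $m$ the true density of the i.i.d. data $Y_1,Y_2,\ldots$, and $f_n$ the predictive recursion (PR) estimates computed from $Y_1,\ldots,Y_n$ with weights $\{w_n\}\subset(0,1)$ and initial density $f_0\in\mathbb{F}$. Assume: (1) $u\mapsto p(y\mid u)$ is continuous for each $y\in\mathcal{Y}$; (2) $f\mapsto m_f$ is one-to-one on $\mathbb{F}$; (3) $\sum_n w_n=\infty$ and $\sum_n w_n^{1+\varepsilon}<\infty$ for some $\varepsilon\in(0,1]$; (4) $w_{n+1}^{-1}-w_n^{-1}\to 0$ as $n\to\infty$; (5) $K(m,m_f)<\infty$ for all $f\in\mathbb{F}$, and the unique minimizer $f^\star$ of $f\mapsto K(m,m_f)$ over $\mathbb{F}$ lies in the interior of $\mathbb{F}$ (i.e. $f^\star(u)>0$ for all $u\in\mathcal{U}$). Then for $\delta\in(0,(1-\varepsilon)/2]$, with $\varepsilon$ as in (3), $\|f_n-f^\star\|=o(w_n^\delta)$ almost surely as $n\to\infty$.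
   Context: Setting. $\mathcal{U}$ is a finite set of size $s$; $\mathbb{F}=\{f\in\mathbb{R}^{\mathcal{U}}: f(u)\ge 0,\ \sum_u f(u)=1\}$ is the $(s-1)$-dimensional probability simplex, i.e. the set of all densities with respect to counting measure on $\mathcal{U}$; vectors are indexed by $\mathcal{U}$ and $\|\cdot\|$ is the Euclidean norm. For each $u\in\mathcal{U}$, $p(\cdot\mid u)$ is a known probability density on $\mathcal{Y}$ with respect to a fixed dominating measure $dy$. For $f\in\mathbb{F}$, $m_f(y)=\sum_{u\in\mathcal{U}}p(y\mid u)f(u)$. The data $Y_1,Y_2,\ldots$ are i.i.d. with density $m$ on $\mathcal{Y}$, where $m$ need not be of the form $m_f$ (the model may be misspecified). Kullback–Leibler divergence: $K(m,m')=\int \log\{m(y)/m'(y)\}\,m(y)\,dy$. PR algorithm: given $f_0\in\mathbb{F}$ and weights $w_i\in(0,1)$, for $i\ge1$ set $$f_i(u)=(1-w_i)f_{i-1}(u)+w_i\,\frac{p(Y_i\mid u)f_{i-1}(u)}{m_{f_{i-1}}(Y_i)},\qquad u\in\mathcal{U}.$$ The existence and uniqueness of the minimizer $f^\star$ of $K(m,m_f)$ are part of the setting (in the source they are consequences of (1) and (2)).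
   Formalization: The initial density is additionally assumed strictly positive, f_0(u)>0 for all u; for f_0 on the boundary of F the claim is false, since f_n(u)=0 for all n whenever f_0(u)=0, while f*(u)>0. *)

theory Defs
  imports "HOL-Probability.Probability" "HOL-Library.Landau_Symbols"
begin

text \<open>The finite set on which the mixing densities live is the whole type \<open>'u\<close>.\<close>

definition prob_simplex :: "(real ^ 'u::finite) set" where
  "prob_simplex = {f. (\<forall>u. 0 \<le> f $ u) \<and> (\<Sum>u\<in>UNIV. f $ u) = 1}"

definition prob_density :: "'y measure \<Rightarrow> ('y \<Rightarrow> real) \<Rightarrow> bool" where
  "prob_density N h \<longleftrightarrow>
     h \<in> borel_measurable N \<and> (\<forall>y\<in>space N. 0 \<le> h y) \<and> (\<integral>\<^sup>+ y. ennreal (h y) \<partial>N) = 1"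

text \<open>The kernel \<open>p(y | u)\<close> is written \<open>p u y\<close>.\<close>

definition mixture :: "('u::finite \<Rightarrow> 'y \<Rightarrow> real) \<Rightarrow> real ^ 'u \<Rightarrow> 'y \<Rightarrow> real" where
  "mixture p f y = (\<Sum>u\<in>UNIV. p u y * f $ u)"

text \<open>Kullback--Leibler divergence between densities, with values in the extended reals. The
  library constant \<^const>\<open>KL_divergence\<close> is a Bochner integral, hence real-valued and \<open>0\<close> when
  the integral diverges, so it cannot express finiteness; lemma \<open>KL_eq_KL_divergence\<close> below shows
  that the two agree when the divergence is finite. The integrand \<open>a log (a / b)\<close> uses the usual
  conventions \<open>0 log (0 / b) = 0\<close> and \<open>a log (a / 0) = \<infinity>\<close> for \<open>a > 0\<close>.\<close>

definition KL_integrand :: "real \<Rightarrow> real \<Rightarrow> ereal" where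
  "KL_integrand a b = (if a = 0 then 0 else if b = 0 then \<infinity> else ereal (a * ln (a / b)))"

text \<open>Positive part minus negative part (\<^const>\<open>e2ennreal\<close> sends negative numbers to \<open>0\<close>). For
  probability densities the negative part is finite, so \<open>\<infinity> - \<infinity>\<close> does not arise.\<close>

definition KL :: "'y measure \<Rightarrow> ('y \<Rightarrow> real) \<Rightarrow> ('y \<Rightarrow> real) \<Rightarrow> ereal" where
  "KL N g h =
     enn2ereal (\<integral>\<^sup>+ y. e2ennreal (KL_integrand (g y) (h y)) \<partial>N) -
     enn2ereal (\<integral>\<^sup>+ y. e2ennreal (- KL_integrand (g y) (h y)) \<partial>N)"

lemma KL_neg_part_le:
  assumes g: "prob_density N g" and h: "prob_density N h"
  shows "(\<integral>\<^sup>+ y. e2ennreal (- KL_integrand (g y) (h y)) \<partial>N) \<le> 1"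
proof -
  have "(\<integral>\<^sup>+ y. e2ennreal (- KL_integrand (g y) (h y)) \<partial>N) \<le> (\<integral>\<^sup>+ y. ennreal (h y) \<partial>N)"
  proof (rule nn_integral_mono)
    fix y assume y: "y \<in> space N"
    have nn: "0 \<le> g y" "0 \<le> h y" using g h y by (auto simp: prob_density_def)
    show "e2ennreal (- KL_integrand (g y) (h y)) \<le> ennreal (h y)"
    proof (cases "g y = 0 \<or> h y = 0")
      case True
      then show ?thesis by (auto simp: KL_integrand_def e2ennreal_neg)
    next
      case False
      then have pos: "0 < g y" "0 < h y" using nn by auto
      have "ln (h y / g y) \<le> h y / g y"
        using ln_le_minus_one[of "h y / g y"] pos by simp
      then have "g y * ln (h y / g y) \<le> h y"
        using pos by (simp add: field_simps)
      moreover have "ln (h y / g y) = - ln (g y / h y)"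
        using pos by (simp add: ln_div)
      ultimately have "- (g y * ln (g y / h y)) \<le> h y" by simp
      then show ?thesis
        using False by (simp add: KL_integrand_def ennreal_leI)
    qed
  qed
  also have "\<dots> = 1" using h by (simp add: prob_density_def)
  finally show ?thesis .
qed

lemma KL_eq_KL_divergence:
  assumes "sigma_finite_measure N"
    and g: "prob_density N g" and h: "prob_density N h" and fin: "KL N g h < \<infinity>"
  shows "KL N g h =
    ereal (KL_divergence (exp 1) (density N (\<lambda>y. ennreal (h y))) (density N (\<lambda>y. ennreal (g y))))"
proof -
  interpret sigma_finite_measure N by fact
  have [measurable]: "g \<in> borel_measurable N" "h \<in> borel_measurable N"
    using g h by (auto simp: prob_density_def)
  have AE_nn: "AE y in N. 0 \<le> g y" "AE y in N. 0 \<le> h y"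
    using g h by (auto simp: prob_density_def)
  let ?P = "\<integral>\<^sup>+ y. e2ennreal (KL_integrand (g y) (h y)) \<partial>N"
  let ?M = "\<integral>\<^sup>+ y. e2ennreal (- KL_integrand (g y) (h y)) \<partial>N"
  let ?k = "\<lambda>y. g y * ln (g y / h y)"
  have M_fin: "?M < \<infinity>"
    using KL_neg_part_le[OF g h] by (auto intro: le_less_trans)
  have P_fin: "?P < \<infinity>"
  proof (rule ccontr)
    assume "\<not> ?P < \<infinity>"
    then have "?P = \<infinity>" using less_top by fastforce
    moreover obtain r where "?M = ennreal r" "0 \<le> r" using M_fin by (cases ?M) auto
    ultimately have "KL N g h = \<infinity>" unfolding KL_def by (simp add: enn2ereal_ennreal)
    then show False using fin by simp
  qed
  have [measurable]: "(\<lambda>y. KL_integrand (g y) (h y)) \<in> borel_measurable N"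
    unfolding KL_integrand_def by measurable
  have "AE y in N. e2ennreal (KL_integrand (g y) (h y)) \<noteq> \<infinity>"
    using P_fin by (intro nn_integral_PInf_AE) (auto simp: less_top)
  then have ac: "AE y in N. h y = 0 \<longrightarrow> g y = 0"
    by eventually_elim (auto simp: KL_integrand_def split: if_splits)
  have eq: "AE y in N. KL_integrand (g y) (h y) = ereal (?k y)"
    using ac by eventually_elim (auto simp: KL_integrand_def split: if_splits)
  have P: "?P = (\<integral>\<^sup>+ y. ennreal (?k y) \<partial>N)"
    by (rule nn_integral_cong_AE, use eq in eventually_elim) simp
  have M: "?M = (\<integral>\<^sup>+ y. ennreal (- ?k y) \<partial>N)"
    by (rule nn_integral_cong_AE, use eq in eventually_elim) simp
  have int: "integrable N ?k"
    using P_fin M_fin unfolding P M real_integrable_def by (auto simp: less_top)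
  have "KL_divergence (exp 1) (density N (\<lambda>y. ennreal (h y))) (density N (\<lambda>y. ennreal (g y))) =
      (\<integral>y. g y * log (exp 1) (g y / h y) \<partial>N)"
    using AE_nn ac by (intro KL_density_density) auto
  also have "\<dots> = (\<integral>y. ?k y \<partial>N)" by (simp add: log_def)
  also have "\<dots> = enn2real ?P - enn2real ?M"
    unfolding P M by (rule real_lebesgue_integral_def[OF int])
  finally have 1: "KL_divergence (exp 1) (density N (\<lambda>y. ennreal (h y)))
      (density N (\<lambda>y. ennreal (g y))) = enn2real ?P - enn2real ?M" .
  obtain r where r: "?P = ennreal r" "0 \<le> r" using P_fin by (cases ?P) auto
  obtain q where q: "?M = ennreal q" "0 \<le> q" using M_fin by (cases ?M) auto
  show ?thesis
    unfolding 1 KL_def r(1) q(1) using r(2) q(2) by (simp add: enn2ereal_ennreal)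
qed

text \<open>Predictive recursion along a data sequence \<open>y 1, y 2, \<dots>\<close>; the values \<open>y 0\<close> and \<open>w 0\<close> are
  never used.\<close>

primrec pred_rec ::
  "('u::finite \<Rightarrow> 'y \<Rightarrow> real) \<Rightarrow> (nat \<Rightarrow> real) \<Rightarrow> real ^ 'u \<Rightarrow> (nat \<Rightarrow> 'y) \<Rightarrow> nat \<Rightarrow> real ^ 'u"
where
  "pred_rec p w f0 y 0 = f0"
| "pred_rec p w f0 y (Suc i) =
     (let f = pred_rec p w f0 y i in
      \<chi> u. (1 - w (Suc i)) * f $ u
           + w (Suc i) * (p u (y (Suc i)) * f $ u / mixture p f (y (Suc i))))"

text \<open>A coordinate at which the initial density vanishes stays zero forever. Convergence to a
  strictly positive limit therefore requires a strictly positive initial density.\<close>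

lemma pred_rec_eq_0: "f0 $ u = 0 \<Longrightarrow> pred_rec p w f0 y n $ u = 0"
  by (induction n) (simp_all add: Let_def)

end

theory Submission
  imports Defs
begin

text \<open>
  Write \<open>m_f\<close> for the mixture and \<open>r u = p (y | u) / m_f y\<close>. Along predictive recursion the relative
  entropy \<open>V f = \<Sum> u. fstar u * ln (fstar u / f u)\<close> changes by \<open>- \<Sum> u. fstar u * ln (1 + w * (r u - 1))\<close>.
  Jensen's inequality bounds the mean of \<open>\<Sum> u. fstar u * (r u - 1) = m_fstar / m_f - 1\<close> from below by
  \<open>K (m, m_f) - K (m, m_fstar)\<close>. No second moments of \<open>r u\<close> are available; replacing \<open>r u\<close> by \<open>min (r u) B\<close>
  with \<open>B\<close> large keeps half of this drift and leaves bounded increments, whose martingale part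
  converges since \<open>\<Sum> w\<^sup>2 < \<infinity>\<close>. As \<open>\<Sum> w = \<infinity>\<close>, this forces \<open>V \<longlonglongrightarrow> 0\<close>, hence \<open>f \<longlonglongrightarrow> fstar\<close>.

  Near \<open>fstar\<close> the mean field of the recursion is, in the inner product \<open>\<Sum> u. x u * y u / fstar u\<close>,
  strictly contracting: its linearization is the negative of the Fisher information, which is definite on
  the tangent space by uniqueness of the minimizer. The weighted noise \<open>w powr (1 - \<delta>) * M\<close> is
  summable because \<open>2 * (1 - \<delta>) \<ge> 1 + \<epsilon>\<close>, and after adding the tail of this series to
  \<open>(f - fstar) / w powr \<delta>\<close> a deterministic contracting recursion remains.
\<close>

section \<open>Stochastic approximation along a fixed path\<close>

text \<open>Truncation enters only through the bookkeeping of the relative entropy: a smaller ratio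
  only weakens the guaranteed decrease, so the recursion itself is unchanged. Its own noise is
  bounded without truncation, because \<open>p u y * f u / m_f y\<close> is a posterior weight in
  [0, 1]. The ratios \<open>p u y / m_f y\<close> may blow up as f approaches the boundary of the
  simplex, so no second-order expansion holds uniformly. Consistency therefore has to come first:
  near fstar all coordinates stay away from 0, and the expansion has explicit constants. Interiority
  has a second effect. Perturbations of fstar are possible in both directions, so the first-order
  conditions are equalities and the mean field vanishes at fstar. Its factor \<open>f u\<close>
  would make the linearization asymmetric in the standard inner product, which explains the weights
  \<open>1 / fstar u\<close>. Dividing the error by \<open>w powr \<delta>\<close> changes one step
  by a factor \<open>1 + o(w)\<close>, since consecutive inverse weights differ by o(1). The
  contraction absorbs this for every \<delta> \<le> 1; the upper limit on \<delta> comes from the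
  noise alone.\<close>

lemma partial_sums_at_top:
  fixes w :: "nat \<Rightarrow> real"
  assumes nn: "\<And>n. 0 \<le> w n" and div: "\<not> summable w"
  shows "filterlim (\<lambda>k. \<Sum>i<k. w (N + i)) at_top sequentially"
proof -
  have inc: "incseq (\<lambda>k. \<Sum>i<k. w (N + i))"
    by (intro incseq_SucI) (simp add: nn)
  have nb: "\<exists>k. C < (\<Sum>i<k. w (N + i))" for C
  proof (rule ccontr)
    assume "\<not> ?thesis"
    then have "\<And>k. (\<Sum>i<k. w (N + i)) \<le> C" by (auto simp: not_less)
    then have "summable (\<lambda>i. w (N + i))"
      by (intro summableI_nonneg_bounded[where x = C]) (use nn in auto)
    then have "summable (\<lambda>i. w (i + N))" by (simp add: add.commute)
    then show False using div summable_iff_shift by blast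
  qed
  show ?thesis
  proof (subst filterlim_at_top, rule allI)
    fix Z :: real
    obtain k where "Z < (\<Sum>i<k. w (N + i))" using nb by blast
    then show "\<forall>\<^sub>F k in sequentially. Z \<le> (\<Sum>i<k. w (N + i))"
      using inc by (intro eventually_sequentiallyI[of k]) (meson incseqD less_le_trans less_imp_le)
  qed
qed

text \<open>Once \<open>l * w n < 1\<close> and \<open>b n < l * h\<close>, the level h is preserved
  by the recursion, and the excess over h is multiplied by at most
  \<open>1 - l * w n \<le> exp (- l * w n)\<close>. Divergence of the weights sends the product of
  these factors to 0.\<close>

lemma contracting_recursion_tendsto_0:
  fixes a b w :: "nat \<Rightarrow> real"
  assumes a: "\<And>n. 0 \<le> a n" and l: "0 < l"
    and w: "\<And>n. 0 \<le> w n" "w \<longlonglongrightarrow> 0" "\<not> summable w"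
    and b: "b \<longlonglongrightarrow> 0"
    and rec: "\<forall>\<^sub>F n in sequentially. a (Suc n) \<le> (1 - l * w n) * a n + w n * b n"
  shows "a \<longlonglongrightarrow> 0"
proof (rule LIMSEQ_I)
  fix r :: real assume r: "0 < r"
  define h where "h = r / 2"
  have h: "0 < h" "h < r" using r by (auto simp: h_def)
  have "\<forall>\<^sub>F n in sequentially. w n < 1 / l"
    using order_tendstoD(2)[OF w(2)] l by simp
  moreover have "\<forall>\<^sub>F n in sequentially. b n < l * h"
    using order_tendstoD(2)[OF b] l h by simp
  ultimately have "\<forall>\<^sub>F n in sequentially. w n < 1 / l \<and> b n < l * h \<and>
      a (Suc n) \<le> (1 - l * w n) * a n + w n * b n"
    using rec by eventually_elim auto
  then obtain N where N: "\<And>n. n \<ge> N \<Longrightarrow> w n < 1 / l \<and> b n < l * h \<and>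
      a (Suc n) \<le> (1 - l * w n) * a n + w n * b n"
    by (auto simp: eventually_sequentially)
  define S where "S k = (\<Sum>i<k. w (N + i))" for k
  have le: "a (N + k) \<le> h + exp (- l * S k) * a N" for k
  proof (induction k)
    case 0
    show ?case using h by (simp add: S_def)
  next
    case (Suc k)
    let ?w = "w (N + k)"
    have lw: "0 \<le> 1 - l * ?w" using N[of "N + k"] l by (simp add: field_simps)
    have "a (N + Suc k) \<le> (1 - l * ?w) * a (N + k) + ?w * b (N + k)"
      using N[of "N + k"] by simp
    also have "\<dots> \<le> (1 - l * ?w) * (h + exp (- l * S k) * a N) + ?w * (l * h)"
      using N[of "N + k"] lw Suc w(1) by (intro add_mono mult_left_mono) auto
    also have "\<dots> = h + (1 - l * ?w) * (exp (- l * S k) * a N)"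
      by (simp add: algebra_simps)
    also have "\<dots> \<le> h + exp (- l * ?w) * (exp (- l * S k) * a N)"
      using exp_ge_add_one_self[of "- l * ?w"] a
      by (intro add_left_mono mult_right_mono) auto
    also have "\<dots> = h + exp (- l * S (Suc k)) * a N"
      by (simp add: S_def exp_add[symmetric] algebra_simps)
    finally show ?case .
  qed
  have "filterlim S at_top sequentially"
    unfolding S_def by (rule partial_sums_at_top) (use w in auto)
  then have "filterlim (\<lambda>k. - l * S k) at_bot sequentially"
    using filterlim_tendsto_neg_mult_at_bot[OF tendsto_const[of "- l"]] l by simp
  then have "(\<lambda>k. exp (- l * S k)) \<longlonglongrightarrow> 0"
    using filterlim_compose[OF exp_at_bot] by blast
  then have "(\<lambda>k. h + exp (- l * S k) * a N) \<longlonglongrightarrow> h + 0 * a N"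
    by (intro tendsto_intros)
  then have "\<forall>\<^sub>F k in sequentially. h + exp (- l * S k) * a N < r"
    using h by (intro order_tendstoD) auto
  then obtain k0 where k0: "\<And>k. k \<ge> k0 \<Longrightarrow> h + exp (- l * S k) * a N < r"
    by (auto simp: eventually_sequentially)
  have "norm (a n - 0) < r" if "n \<ge> N + k0" for n
  proof -
    have n: "N + (n - N) = n" "k0 \<le> n - N" using that by auto
    show ?thesis using le[of "n - N", unfolded n(1)] k0[OF n(2)] a[of n] by simp
  qed
  then show "\<exists>no. \<forall>n\<ge>no. norm (a n - 0) < r" by blast
qed

text \<open>For an exponent in [0, 1] the power lies between 1 and x. This compares powers of weight
  ratios with the ratios themselves.\<close>

lemma abs_powr_minus_one_le:
  fixes x d :: real
  assumes "0 < x" "0 \<le> d" "d \<le> 1"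
  shows "\<bar>x powr d - 1\<bar> \<le> \<bar>x - 1\<bar>"
proof (cases "1 \<le> x")
  case True
  then have "1 \<le> x powr d" "x powr d \<le> x powr 1"
    using assms by (blast intro: ge_one_powr_ge_zero powr_mono)+
  then show ?thesis using True by simp
next
  case False
  then have "x powr d \<le> 1" using assms by (intro powr_le1) auto
  moreover have "x powr 1 \<le> x powr d" by (rule powr_mono') (use False assms in auto)
  ultimately show ?thesis using False assms by simp
qed

text \<open>Here e is the error, d the mean field and \<zeta> the noise. The normalized error z
  carries the noise terms v, and adding their tail sum S cancels them exactly:
  \<open>x = z + S\<close> moves by \<open>w (Suc n) *\<^sub>R g n\<close>. As g is contracting in z
  and not in x, the mismatch S remains as a forcing term, which tends to 0.\<close>

lemma stochastic_approximation_rate: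
  fixes e d \<zeta> :: "nat \<Rightarrow> 'a::euclidean_space" and w :: "nat \<Rightarrow> real"
  assumes w: "\<And>n. 0 < w (Suc n)" "w \<longlonglongrightarrow> 0" "\<not> summable (\<lambda>n. w (Suc n))"
    and w_inv: "(\<lambda>n. inverse (w (Suc n)) - inverse (w n)) \<longlonglongrightarrow> 0"
    and \<delta>: "0 \<le> \<delta>" "\<delta> \<le> 1"
    and rec: "\<And>n. e (Suc n) = e n + w (Suc n) *\<^sub>R (d n + \<zeta> n)"
    and noise: "summable (\<lambda>n. w (Suc n) powr (1 - \<delta>) *\<^sub>R \<zeta> n)"
    and c: "0 < c" and inner_d: "\<forall>\<^sub>F n in sequentially. inner (e n) (d n) \<le> - c * (norm (e n))\<^sup>2"
    and norm_d: "\<forall>\<^sub>F n in sequentially. norm (d n) \<le> C * norm (e n)"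
  shows "(\<lambda>n. norm (e n) / w n powr \<delta>) \<longlonglongrightarrow> 0"
proof -
  \<comment> \<open>\<rho> changes the normalization from \<open>w n\<close> to
    \<open>w (Suc n)\<close>; \<alpha> is the resulting relative change per unit of step
    size.\<close>
  define \<rho> where "\<rho> n = (w n / w (Suc n)) powr \<delta>" for n
  define \<alpha> where "\<alpha> n = (\<rho> n - 1) / w (Suc n)" for n
  define z where "z n = (1 / w n powr \<delta>) *\<^sub>R e n" for n
  define v where "v n = w (Suc n) powr (1 - \<delta>) *\<^sub>R \<zeta> n" for n
  define S where "S n = (\<Sum>k. v (k + n))" for n
  define g where "g n = \<alpha> n *\<^sub>R z n + (\<rho> n / w n powr \<delta>) *\<^sub>R d n" for n
  define x where "x n = z n + S n" for n
  \<comment> \<open>The value \<open>w 0\<close> is unconstrained, so normalizing by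
    \<open>w n\<close> is meaningful only from 1 on.\<close>
  have pos: "\<forall>\<^sub>F n in sequentially. 0 < w n"
    using w(1) by (intro eventually_sequentiallyI[of 1]) (metis One_nat_def Suc_le_D)
  have w_Suc: "(\<lambda>n. w (Suc n)) \<longlonglongrightarrow> 0" using w(2) by (rule LIMSEQ_Suc)
  have "v = (\<lambda>n. w (Suc n) powr (1 - \<delta>) *\<^sub>R \<zeta> n)" by (rule ext) (simp add: v_def)
  with noise have sv: "summable v" by simp
  have S0: "S \<longlonglongrightarrow> 0"
    unfolding S_def by (rule suminf_exist_split2[OF sv])
  have S_Suc: "S n = v n + S (Suc n)" for n
  proof -
    have "summable (\<lambda>k. v (k + n))" using sv by (subst summable_iff_shift)
    from suminf_split_head[OF this] show ?thesis by (simp add: S_def)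
  qed
  have ratio_eq: "\<forall>\<^sub>F n in sequentially.
      1 + w n * (inverse (w (Suc n)) - inverse (w n)) = w n / w (Suc n)"
    using pos by eventually_elim (use w(1) in \<open>simp add: field_simps\<close>)
  have "(\<lambda>n. 1 + w n * (inverse (w (Suc n)) - inverse (w n))) \<longlonglongrightarrow> 1 + 0 * 0"
    by (intro tendsto_intros w w_inv)
  then have ratio: "(\<lambda>n. w n / w (Suc n)) \<longlonglongrightarrow> 1"
    using filterlim_cong[OF refl refl ratio_eq] by simp
  have "(\<lambda>n. (w n / w (Suc n)) powr \<delta>) \<longlonglongrightarrow> 1 powr \<delta>"
    by (intro tendsto_powr ratio tendsto_const) simp
  then have \<rho>: "\<rho> \<longlonglongrightarrow> 1" by (simp add: \<rho>_def[abs_def])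
  \<comment> \<open>By the power inequality \<alpha> is at most
    \<open>(w n / w (Suc n) - 1) / w (Suc n)\<close> in absolute value, which is the weight ratio
    times the difference of inverse weights.\<close>
  have \<alpha>: "\<alpha> \<longlonglongrightarrow> 0"
  proof (rule Lim_null_comparison)
    show "\<forall>\<^sub>F n in sequentially. norm (\<alpha> n) \<le>
        \<bar>(w n / w (Suc n)) * (inverse (w (Suc n)) - inverse (w n))\<bar>"
      using pos
    proof eventually_elim
      case (elim n)
      have "\<bar>\<rho> n - 1\<bar> \<le> \<bar>w n / w (Suc n) - 1\<bar>"
        unfolding \<rho>_def by (rule abs_powr_minus_one_le) (use elim w(1) \<delta> in auto)
      then have "\<bar>\<rho> n - 1\<bar> / w (Suc n) \<le> \<bar>w n / w (Suc n) - 1\<bar> / w (Suc n)"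
        using w(1)[of n] by (intro divide_right_mono) auto
      also have "\<dots> = \<bar>(w n / w (Suc n) - 1) / w (Suc n)\<bar>"
        using w(1)[of n] by (simp add: abs_divide)
      also have "(w n / w (Suc n) - 1) / w (Suc n) =
          (w n / w (Suc n)) * (inverse (w (Suc n)) - inverse (w n))"
        using w(1)[of n] elim by (simp add: field_simps)
      finally show ?case using w(1)[of n] by (simp add: \<alpha>_def abs_divide)
    qed
    have "(\<lambda>n. \<bar>(w n / w (Suc n)) * (inverse (w (Suc n)) - inverse (w n))\<bar>) \<longlonglongrightarrow> \<bar>1 * 0\<bar>"
      by (intro tendsto_intros ratio w_inv)
    then show "(\<lambda>n. \<bar>(w n / w (Suc n)) * (inverse (w (Suc n)) - inverse (w n))\<bar>) \<longlonglongrightarrow> 0"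
      by simp
  qed
  have z_rec: "\<forall>\<^sub>F n in sequentially. x (Suc n) = x n + w (Suc n) *\<^sub>R g n"
    using pos
  proof eventually_elim
    case (elim n)
    have ws: "0 < w (Suc n)" by (rule w)
    have 1: "\<rho> n / w n powr \<delta> = 1 / w (Suc n) powr \<delta>"
      using elim ws by (simp add: \<rho>_def powr_divide)
    have 2: "w (Suc n) / w (Suc n) powr \<delta> = w (Suc n) powr (1 - \<delta>)"
      using ws by (simp add: powr_diff)
    have 3: "\<rho> n = 1 + w (Suc n) * \<alpha> n" using ws by (simp add: \<alpha>_def)
    have "z (Suc n) = (1 / w (Suc n) powr \<delta>) *\<^sub>R e n + (w (Suc n) / w (Suc n) powr \<delta>) *\<^sub>R d n + v n"
      unfolding z_def rec v_def 2[symmetric] by (simp add: algebra_simps)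
    also have "(1 / w (Suc n) powr \<delta>) *\<^sub>R e n = \<rho> n *\<^sub>R z n"
      unfolding z_def 1[symmetric] by simp
    also have "\<rho> n *\<^sub>R z n = z n + w (Suc n) *\<^sub>R \<alpha> n *\<^sub>R z n"
      unfolding 3 by (simp add: algebra_simps)
    also have "(w (Suc n) / w (Suc n) powr \<delta>) *\<^sub>R d n = w (Suc n) *\<^sub>R (\<rho> n / w n powr \<delta>) *\<^sub>R d n"
      unfolding 1 by simp
    finally show ?case
      unfolding x_def g_def S_Suc[of n] by (simp add: algebra_simps)
  qed
  \<comment> \<open>With \<bar>\<alpha>\<bar> < 1 and \<rho> < 2 the Lipschitz constant C grows to
    C1. With \<rho> > 1/2 the contraction c drops to c/2, of which one half is spent on
    \<alpha>.\<close>
  define C1 where "C1 = 1 + 2 * \<bar>C\<bar>"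
  have C1: "0 < C1" by (simp add: C1_def)
  define c1 where "c1 = c / 4"
  have c1: "0 < c1" using c by (simp add: c1_def)
  have ev_\<rho>: "\<forall>\<^sub>F n in sequentially. 1 / 2 < \<rho> n" "\<forall>\<^sub>F n in sequentially. \<rho> n < 2"
    by (rule order_tendstoD[OF \<rho>], simp)+
  have \<alpha>': "(\<lambda>n. \<bar>\<alpha> n\<bar>) \<longlonglongrightarrow> 0" using \<alpha> by (simp add: tendsto_rabs_zero)
  have ev_\<alpha>: "\<forall>\<^sub>F n in sequentially. \<bar>\<alpha> n\<bar> < min 1 c1"
    by (rule order_tendstoD(2)[OF \<alpha>']) (simp add: c1)
  have g_bounds: "\<forall>\<^sub>F n in sequentially. norm (g n) \<le> C1 * norm (z n) \<and>
      inner (z n) (g n) \<le> - c1 * (norm (z n))\<^sup>2"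
    using pos ev_\<rho> ev_\<alpha> inner_d norm_d
  proof eventually_elim
    case (elim n)
    define q where "q = 1 / w n powr \<delta>"
    have q: "0 < q" using elim by (simp add: q_def)
    have z: "z n = q *\<^sub>R e n" by (simp add: z_def q_def)
    have g: "g n = \<alpha> n *\<^sub>R z n + (\<rho> n * q) *\<^sub>R d n" by (simp add: g_def q_def)
    have "norm (g n) \<le> \<bar>\<alpha> n\<bar> * norm (z n) + (\<rho> n * q) * norm (d n)"
      unfolding g using norm_triangle_ineq[of "\<alpha> n *\<^sub>R z n" "(\<rho> n * q) *\<^sub>R d n"] q elim
      by (simp add: abs_mult)
    also have "\<dots> \<le> 1 * norm (z n) + (2 * q) * (\<bar>C\<bar> * norm (e n))"
    proof (intro add_mono mult_mono)
      have "C * norm (e n) \<le> \<bar>C\<bar> * norm (e n)" by (intro mult_right_mono) auto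
      then show "norm (d n) \<le> \<bar>C\<bar> * norm (e n)" using elim by linarith
    qed (use q elim in auto)
    also have "\<dots> = C1 * norm (z n)" using q by (simp add: C1_def z algebra_simps)
    finally have 1: "norm (g n) \<le> C1 * norm (z n)" .
    have "inner (z n) (g n) = \<alpha> n * inner (z n) (z n) + \<rho> n * q\<^sup>2 * inner (e n) (d n)"
      unfolding g by (simp add: inner_add_right z power2_eq_square)
    also have "inner (z n) (z n) = (norm (z n))\<^sup>2" by (simp add: power2_norm_eq_inner)
    finally have "inner (z n) (g n) = \<alpha> n * (norm (z n))\<^sup>2 + \<rho> n * q\<^sup>2 * inner (e n) (d n)" .
    also have "\<dots> \<le> c1 * (norm (z n))\<^sup>2 + \<rho> n * q\<^sup>2 * (- c * (norm (e n))\<^sup>2)"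
      using elim q by (intro add_mono mult_right_mono mult_left_mono) auto
    also have "\<dots> = c1 * (norm (z n))\<^sup>2 - \<rho> n * (c * (norm (z n))\<^sup>2)"
      using q by (simp add: z power_mult_distrib)
    also have "\<dots> \<le> c1 * (norm (z n))\<^sup>2 - (1/2) * (c * (norm (z n))\<^sup>2)"
      using elim c by (intro diff_left_mono mult_right_mono) auto
    also have "\<dots> = - c1 * (norm (z n))\<^sup>2" by (simp add: c1_def)
    finally show ?case using 1 by simp
  qed
  \<comment> \<open>Completing the square in the cross term of S and g leaves
    \<open>2 * C1\<^sup>2 / c1\<close>; passing from the norm of z to that of x adds
    \<open>c1 / 2\<close>. The threshold on w below makes the quadratic term of the step at most
    \<open>c1\<close> times the squared norm of z.\<close>
  define K where "K = c1 / 2 + 2 * C1\<^sup>2 / c1"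
  have "\<forall>\<^sub>F n in sequentially. w (Suc n) < c1 / C1\<^sup>2"
    using order_tendstoD(2)[OF w_Suc] c1 C1 by simp
  then have x_rec: "\<forall>\<^sub>F n in sequentially. (norm (x (Suc n)))\<^sup>2 \<le>
      (1 - (c1 / 4) * w (Suc n)) * (norm (x n))\<^sup>2 + w (Suc n) * (K * (norm (S n))\<^sup>2)"
    using z_rec g_bounds
  proof eventually_elim
    case (elim n)
    let ?w = "w (Suc n)" and ?Z = "norm (z n)" and ?s = "norm (S n)"
    have ws: "0 < ?w" by (rule w)
    have "(norm (x (Suc n)))\<^sup>2 = (norm (x n))\<^sup>2 + ?w * (2 * inner (x n) (g n) + ?w * (norm (g n))\<^sup>2)"
      using elim by (simp add: power2_norm_eq_inner inner_add_left inner_add_right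
          inner_commute algebra_simps)
    moreover have "2 * inner (x n) (g n) + ?w * (norm (g n))\<^sup>2 \<le> - (c1 / 4) * (norm (x n))\<^sup>2 + K * ?s\<^sup>2"
    proof -
      have gz: "(norm (g n))\<^sup>2 \<le> C1\<^sup>2 * ?Z\<^sup>2"
        using elim power_mono[of "norm (g n)" "C1 * ?Z" 2] by (simp add: power_mult_distrib)
      have "?w * (norm (g n))\<^sup>2 \<le> (c1 / C1\<^sup>2) * (C1\<^sup>2 * ?Z\<^sup>2)"
        using elim gz ws c1 by (intro mult_mono) auto
      then have 1: "?w * (norm (g n))\<^sup>2 \<le> c1 * ?Z\<^sup>2" using C1 by simp
      have "inner (S n) (g n) \<le> ?s * norm (g n)" by (rule norm_cauchy_schwarz)
      also have "\<dots> \<le> ?s * (C1 * ?Z)" using elim by (intro mult_left_mono) auto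
      finally have 2: "inner (S n) (g n) \<le> ?s * (C1 * ?Z)" .
      have 3: "inner (x n) (g n) \<le> - c1 * ?Z\<^sup>2 + ?s * (C1 * ?Z)"
        unfolding x_def using 2 elim by (simp add: inner_add_left)
      have "0 \<le> (c1 * ?Z - 2 * C1 * ?s)\<^sup>2 / (2 * c1)" using c1 by simp
      also have "\<dots> = c1 / 2 * ?Z\<^sup>2 - 2 * C1 * ?s * ?Z + 2 * C1\<^sup>2 / c1 * ?s\<^sup>2"
        using c1 by (simp add: power2_eq_square field_simps)
      finally have 4: "2 * (?s * (C1 * ?Z)) \<le> c1 / 2 * ?Z\<^sup>2 + 2 * C1\<^sup>2 / c1 * ?s\<^sup>2"
        by (simp add: algebra_simps)
      have "(norm (x n))\<^sup>2 \<le> (?Z + ?s)\<^sup>2"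
        unfolding x_def by (intro power_mono norm_triangle_ineq) auto
      also have "\<dots> \<le> 2 * ?Z\<^sup>2 + 2 * ?s\<^sup>2"
        using zero_le_power2[of "?Z - ?s"] by (simp add: power2_eq_square algebra_simps)
      finally have "(c1 / 4) * (norm (x n))\<^sup>2 \<le> (c1 / 4) * (2 * ?Z\<^sup>2 + 2 * ?s\<^sup>2)"
        using c1 by (intro mult_left_mono) auto
      then have 5: "(c1 / 4) * (norm (x n))\<^sup>2 \<le> c1 / 2 * ?Z\<^sup>2 + c1 / 2 * ?s\<^sup>2"
        by (simp add: algebra_simps)
      have K: "K * ?s\<^sup>2 = c1 / 2 * ?s\<^sup>2 + 2 * C1\<^sup>2 / c1 * ?s\<^sup>2"
        by (simp add: K_def algebra_simps)
      show ?thesis using 1 3 4 5 K by linarith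
    qed
    ultimately have "(norm (x (Suc n)))\<^sup>2 \<le>
        (norm (x n))\<^sup>2 + ?w * (- (c1 / 4) * (norm (x n))\<^sup>2 + K * ?s\<^sup>2)"
      using ws by (simp add: mult_left_mono)
    also have "\<dots> = (1 - (c1 / 4) * ?w) * (norm (x n))\<^sup>2 + ?w * (K * ?s\<^sup>2)"
      by (simp add: algebra_simps)
    finally show ?case .
  qed
  have "(\<lambda>n. (norm (x n))\<^sup>2) \<longlonglongrightarrow> 0"
  proof (rule contracting_recursion_tendsto_0[OF _ _ _ w_Suc w(3) _ x_rec])
    have "(\<lambda>n. K * (norm (S n))\<^sup>2) \<longlonglongrightarrow> K * (norm (0::'a))\<^sup>2"
      by (intro tendsto_intros S0)
    then show "(\<lambda>n. K * (norm (S n))\<^sup>2) \<longlonglongrightarrow> 0" by simp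
  qed (use c1 w(1) in \<open>auto intro: less_imp_le\<close>)
  then have "(\<lambda>n. sqrt ((norm (x n))\<^sup>2)) \<longlonglongrightarrow> sqrt 0" by (rule tendsto_real_sqrt)
  then have "x \<longlonglongrightarrow> 0" by (simp add: tendsto_norm_zero_iff)
  then have "(\<lambda>n. norm (x n - S n)) \<longlonglongrightarrow> norm (0 - 0 :: 'a)" by (intro tendsto_intros S0)
  then have "(\<lambda>n. norm (z n)) \<longlonglongrightarrow> 0" by (simp add: x_def)
  then show ?thesis by (simp add: z_def)
qed

section \<open>Summability of bounded martingale differences\<close>

text \<open>Vanishing integrals over the sets of F say that the conditional expectation of \<xi>
  given F is 0 almost everywhere, and an F-measurable factor can be pulled out of it.\<close>

lemma (in prob_space) martingale_difference_orthogonal: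
  fixes \<xi> Z :: "'a \<Rightarrow> real"
  assumes F: "subalgebra M F" and \<xi>: "integrable M \<xi>"
    and centred: "\<And>A. A \<in> sets F \<Longrightarrow> (\<integral>x\<in>A. \<xi> x \<partial>M) = 0"
    and Z: "Z \<in> borel_measurable F" and int: "integrable M (\<lambda>x. Z x * \<xi> x)"
  shows "(\<integral>x. Z x * \<xi> x \<partial>M) = 0"
proof -
  interpret finite_measure_subalgebra M F by unfold_locales (rule F)
  have "AE x in M. real_cond_exp M F \<xi> x = (\<lambda>_. 0) x"
    by (rule real_cond_exp_charact) (use \<xi> centred in \<open>auto simp: set_lebesgue_integral_def\<close>)
  then have 0: "AE x in M. Z x * real_cond_exp M F \<xi> x = 0" by eventually_elim simp
  have "(\<integral>x. Z x * \<xi> x \<partial>M) = (\<integral>x. Z x * real_cond_exp M F \<xi> x \<partial>M)"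
    using real_cond_exp_intg(2)[OF int Z] \<xi> by simp
  also have "\<dots> = (\<integral>x. 0 \<partial>M)"
    using 0 measurable_from_subalg[OF F Z] by (intro integral_cong_AE) auto
  finally show ?thesis by simp
qed

text \<open>Kolmogorov's inequality. The stopped sums have orthogonal increments, so their second
  moment is at most the sum of the squared bounds; on the event in question the stopped sum at time
  n is still at level a or beyond, and Markov's inequality applies to its square.\<close>

lemma (in prob_space) martingale_maximal_inequality:
  fixes \<xi> :: "nat \<Rightarrow> 'a \<Rightarrow> real" and c :: "nat \<Rightarrow> real"
  assumes F: "\<And>n. subalgebra M (F n)" and mono: "\<And>n. sets (F n) \<subseteq> sets (F (Suc n))"
    and \<xi>: "\<And>n. \<xi> n \<in> borel_measurable (F (Suc n))"
    and bound: "\<And>n x. x \<in> space M \<Longrightarrow> \<bar>\<xi> n x\<bar> \<le> c n"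
    and centred: "\<And>n A. A \<in> sets (F n) \<Longrightarrow> (\<integral>x\<in>A. \<xi> n x \<partial>M) = 0"
    and a: "0 < a"
  shows "prob {x \<in> space M. \<exists>j\<le>n. a \<le> \<bar>\<Sum>i<j. \<xi> i x\<bar>} \<le> (\<Sum>i<n. (c i)\<^sup>2) / a\<^sup>2"
proof -
  have sub: "f \<in> borel_measurable M" if "f \<in> borel_measurable (F k)" for f :: "'a \<Rightarrow> real" and k
    by (rule measurable_from_subalg[OF F that])
  have step: "f \<in> borel_measurable (F (Suc k))" if "f \<in> borel_measurable (F k)" for f :: "'a \<Rightarrow> real" and k
    using that mono[of k] F[of k] F[of "Suc k"] by (auto simp: measurable_def subalgebra_def)
  have [measurable]: "\<xi> k \<in> borel_measurable M" for k by (rule sub[OF \<xi>])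
  \<comment> \<open>the partial sums stopped on reaching level \<open>a\<close>\<close>
  define U where "U = rec_nat (\<lambda>_. 0) (\<lambda>k u x. u x + (if \<bar>u x\<bar> < a then \<xi> k x else 0))"
  have U0: "U 0 = (\<lambda>_. 0)" by (simp add: U_def)
  have US: "U (Suc k) x = U k x + (if \<bar>U k x\<bar> < a then \<xi> k x else 0)" for k x by (simp add: U_def)
  have U_meas: "U k \<in> borel_measurable (F k)" for k
  proof (induction k)
    case 0 then show ?case by (simp add: U0)
  next
    case (Suc k)
    have [measurable]: "U k \<in> borel_measurable (F (Suc k))" by (rule step[OF Suc])
    have [measurable]: "\<xi> k \<in> borel_measurable (F (Suc k))" by (rule \<xi>)
    show ?case unfolding US[abs_def] by measurable
  qed
  have [measurable]: "U k \<in> borel_measurable M" for k by (rule sub[OF U_meas])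
  have c: "0 \<le> c k" for k using bound[of _ k] not_empty by (metis abs_ge_zero order_trans ex_in_conv)
  have U_bd: "\<bar>U k x\<bar> \<le> (\<Sum>i<k. c i)" if "x \<in> space M" for k x
  proof (induction k)
    case 0 then show ?case by (simp add: U0)
  next
    case (Suc k)
    have "\<bar>U (Suc k) x\<bar> \<le> \<bar>U k x\<bar> + c k"
      using bound[OF that, of k] c[of k] abs_triangle_ineq[of "U k x" "\<xi> k x"] by (auto simp: US)
    then show ?case using Suc by simp
  qed
  have int_U2: "integrable M (\<lambda>x. (U k x)\<^sup>2)" for k
  proof (rule integrable_const_bound[where B = "(\<Sum>i<k. c i)\<^sup>2"])
    show "AE x in M. norm ((U k x)\<^sup>2) \<le> (\<Sum>i<k. c i)\<^sup>2"
    proof (rule AE_I2)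
      fix x assume "x \<in> space M"
      from power_mono[OF U_bd[OF this, of k] abs_ge_zero, of 2]
      show "norm ((U k x)\<^sup>2) \<le> (\<Sum>i<k. c i)\<^sup>2" by simp
    qed
  qed measurable
  have var: "(\<integral>x. (U k x)\<^sup>2 \<partial>M) \<le> (\<Sum>i<k. (c i)\<^sup>2)" for k
  proof (induction k)
    case 0 then show ?case by (simp add: U0)
  next
    case (Suc k)
    \<comment> \<open>The coefficient of the cross term when the stopped sum is squared: known at
      time k, and bounded by 2a thanks to the stopping.\<close>
    define Z where "Z x = (if \<bar>U k x\<bar> < a then 2 * U k x else 0)" for x
    have [measurable]: "U k \<in> borel_measurable (F k)" by (rule U_meas)
    have Z: "Z \<in> borel_measurable (F k)" unfolding Z_def[abs_def] by measurable
    have [measurable]: "Z \<in> borel_measurable M" by (rule sub[OF Z])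
    have intZ: "integrable M (\<lambda>x. Z x * \<xi> k x)"
    proof (rule integrable_const_bound[where B = "2 * a * c k"])
      show "AE x in M. norm (Z x * \<xi> k x) \<le> 2 * a * c k"
        using bound a c[of k] by (intro AE_I2) (auto simp: abs_mult Z_def intro!: mult_mono)
    qed measurable
    have int_\<xi>: "integrable M (\<xi> k)"
      by (rule integrable_const_bound[where B = "c k"]) (use bound in auto)
    have 0: "(\<integral>x. Z x * \<xi> k x \<partial>M) = 0"
      by (rule martingale_difference_orthogonal[OF F int_\<xi> centred Z intZ])
    have "(\<integral>x. (U (Suc k) x)\<^sup>2 \<partial>M) \<le> (\<integral>x. (U k x)\<^sup>2 + (Z x * \<xi> k x + (c k)\<^sup>2) \<partial>M)"
    proof (rule integral_mono)
      fix x assume x: "x \<in> space M"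
      from power_mono[OF bound[OF x, of k] abs_ge_zero, of 2] have "(\<xi> k x)\<^sup>2 \<le> (c k)\<^sup>2" by simp
      then show "(U (Suc k) x)\<^sup>2 \<le> (U k x)\<^sup>2 + (Z x * \<xi> k x + (c k)\<^sup>2)"
        by (simp add: US Z_def power2_eq_square algebra_simps)
    qed (use int_U2 intZ in auto)
    also have "\<dots> = (\<integral>x. (U k x)\<^sup>2 \<partial>M) + (c k)\<^sup>2"
      using int_U2 intZ 0 by (simp add: prob_space)
    finally show ?case using Suc by simp
  qed
  have stay: "U (k + j) x = U k x" if "a \<le> \<bar>U k x\<bar>" for k j x
    using that by (induction j) (auto simp: US)
  have U_eq: "U j x = (\<Sum>i<j. \<xi> i x)" if "\<And>i. i < j \<Longrightarrow> \<bar>U i x\<bar> < a" for j x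
    using that
  proof (induction j)
    case 0 then show ?case by (simp add: U0)
  next
    case (Suc j)
    have "\<bar>U j x\<bar> < a" by (rule Suc.prems) simp
    moreover have "U j x = (\<Sum>i<j. \<xi> i x)" by (rule Suc.IH) (use Suc.prems in auto)
    ultimately show ?case by (simp add: US)
  qed
  \<comment> \<open>If the stopped sum ended below a, it would never have been stopped, so it would
    coincide with the original partial sums at every time up to n.\<close>
  have hit: "a \<le> \<bar>U n x\<bar>" if "j \<le> n" "a \<le> \<bar>\<Sum>i<j. \<xi> i x\<bar>" for j x
  proof (rule ccontr)
    assume "\<not> ?thesis"
    then have "\<bar>U i x\<bar> < a" if "i \<le> n" for i
      using stay[of i x "n - i"] that by fastforce
    with U_eq[of j x] that show False by fastforce
  qed
  have "{x \<in> space M. \<exists>j\<le>n. a \<le> \<bar>\<Sum>i<j. \<xi> i x\<bar>} \<subseteq> {x \<in> space M. a\<^sup>2 \<le> (U n x)\<^sup>2}"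
    using hit a by (auto simp flip: abs_le_square_iff)
  then have "prob {x \<in> space M. \<exists>j\<le>n. a \<le> \<bar>\<Sum>i<j. \<xi> i x\<bar>} \<le> prob {x \<in> space M. a\<^sup>2 \<le> (U n x)\<^sup>2}"
    by (intro finite_measure_mono) auto
  also have "\<dots> \<le> (\<integral>x. (U n x)\<^sup>2 \<partial>M) / a\<^sup>2"
    using integral_Markov_inequality_measure[OF int_U2, of "{}" n "a\<^sup>2"] a by simp
  also have "\<dots> \<le> (\<Sum>i<n. (c i)\<^sup>2) / a\<^sup>2"
    by (intro divide_right_mono var) auto
  finally show ?thesis .
qed

text \<open>Started at index m, the maximal inequality bounds the probability of ever leaving (-a,
  a) by the tail of the squared bounds divided by \<open>a\<^sup>2\<close>. The tail vanishes as m
  grows, so almost surely some m works for each of the countably many levels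
  \<open>1 / Suc r\<close>: the partial sums are Cauchy.\<close>

theorem (in prob_space) martingale_summable_AE:
  fixes \<xi> :: "nat \<Rightarrow> 'a \<Rightarrow> real" and c :: "nat \<Rightarrow> real"
  assumes F: "\<And>n. subalgebra M (F n)" and mono: "\<And>n. sets (F n) \<subseteq> sets (F (Suc n))"
    and \<xi>: "\<And>n. \<xi> n \<in> borel_measurable (F (Suc n))"
    and bound: "\<And>n x. x \<in> space M \<Longrightarrow> \<bar>\<xi> n x\<bar> \<le> c n" and c: "summable (\<lambda>n. (c n)\<^sup>2)"
    and centred: "\<And>n A. A \<in> sets (F n) \<Longrightarrow> (\<integral>x\<in>A. \<xi> n x \<partial>M) = 0"
  shows "AE x in M. summable (\<lambda>n. \<xi> n x)"
proof -
  have [measurable]: "\<xi> k \<in> borel_measurable M" for k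
    by (rule measurable_from_subalg[OF F \<xi>])
  define B where "B a m n = {x \<in> space M. \<exists>j\<le>n. a \<le> \<bar>\<Sum>i<j. \<xi> (i + m) x\<bar>}" for a m n
  define t where "t m = (\<Sum>i. (c (i + m))\<^sup>2)" for m
  have t0: "t \<longlonglongrightarrow> 0" unfolding t_def by (rule suminf_exist_split2[OF c])
  have [measurable]: "B a m n \<in> sets M" for a m n unfolding B_def by measurable
  have pB: "prob (B a m n) \<le> t m / a\<^sup>2" if "0 < a" for a m n
  proof -
    have "prob (B a m n) \<le> (\<Sum>i<n. (c (i + m))\<^sup>2) / a\<^sup>2"
      unfolding B_def
    proof (rule martingale_maximal_inequality[where F = "\<lambda>i. F (i + m)" and c = "\<lambda>i. c (i + m)"])
      show "\<xi> (i + m) \<in> borel_measurable (F (Suc i + m))" for i using \<xi>[of "i + m"] by simp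
      show "sets (F (i + m)) \<subseteq> sets (F (Suc i + m))" for i using mono[of "i + m"] by simp
    qed (use F bound centred that in auto)
    also have "\<dots> \<le> t m / a\<^sup>2"
      unfolding t_def by (intro divide_right_mono sum_le_suminf)
        (use c in \<open>auto simp: summable_iff_shift[of "\<lambda>n. (c n)\<^sup>2"]\<close>)
    finally show ?thesis .
  qed
  have ev: "AE x in M. \<exists>m. \<forall>n. x \<notin> B a m n" if a: "0 < a" for a
  proof -
    \<comment> \<open>The exceptional event lies in the union of \<open>B a m n\<close> over n for
      every single m, so its probability is below every \<open>t m / a\<^sup>2\<close>.\<close>
    let ?A = "{x \<in> space M. \<forall>m. \<exists>n. x \<in> B a m n}"
    have le: "prob ?A \<le> t m / a\<^sup>2" for m
    proof -
      have inc: "incseq (B a m)" unfolding B_def incseq_def by (auto intro: order_trans)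
      have "(\<lambda>n. prob (B a m n)) \<longlonglongrightarrow> prob (\<Union>n. B a m n)"
        by (rule finite_Lim_measure_incseq[OF _ inc]) auto
      then have "prob (\<Union>n. B a m n) \<le> t m / a\<^sup>2"
        by (rule LIMSEQ_le_const2) (use pB[OF a] in auto)
      moreover have "prob ?A \<le> prob (\<Union>n. B a m n)" by (intro finite_measure_mono) auto
      ultimately show ?thesis by simp
    qed
    have "(\<lambda>m. t m / a\<^sup>2) \<longlonglongrightarrow> 0 / a\<^sup>2" by (intro tendsto_intros t0) (use a in auto)
    then have "prob ?A \<le> 0 / a\<^sup>2" by (rule LIMSEQ_le_const) (use le in auto)
    then have "prob ?A = 0" by (simp add: measure_le_0_iff)
    then have "AE x in M. x \<notin> ?A" by (subst (asm) prob_eq_0) auto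
    with AE_space show ?thesis by eventually_elim auto
  qed
  have "AE x in M. \<forall>r::nat. \<exists>m. \<forall>n. x \<notin> B (1 / Suc r) m n"
    unfolding AE_all_countable by (intro allI ev) simp
  with AE_space show ?thesis
  proof eventually_elim
    case (elim x)
    have "\<exists>M. \<forall>m\<ge>M. \<forall>n. norm (sum (\<lambda>i. \<xi> i x) {m..<n}) < e" if "0 < e" for e
    proof -
      obtain r where r: "1 / Suc r < e / 2"
        using nat_approx_posE[of "e / 2"] \<open>0 < e\<close> by auto
      from elim obtain M where M: "\<And>n. x \<notin> B (1 / Suc r) M n" by blast
      have small: "\<bar>\<Sum>i<j. \<xi> (i + M) x\<bar> < e / 2" for j
        using M[of j] elim r by (force simp: B_def not_le)
      have shift: "(\<Sum>i<j. \<xi> (i + M) x) = sum (\<lambda>i. \<xi> i x) {M..<M + j}" for j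
        by (rule sum.reindex_bij_witness[of _ "\<lambda>i. i - M" "\<lambda>i. i + M"]) auto
      have "norm (sum (\<lambda>i. \<xi> i x) {m..<n}) < e" if "M \<le> m" for m n
      proof (cases "m \<le> n")
        case True
        have "sum (\<lambda>i. \<xi> i x) {M..<n} = sum (\<lambda>i. \<xi> i x) {M..<m} + sum (\<lambda>i. \<xi> i x) {m..<n}"
          using that True by (simp add: sum.atLeastLessThan_concat)
        moreover have "\<bar>sum (\<lambda>i. \<xi> i x) {M..<n}\<bar> < e / 2" "\<bar>sum (\<lambda>i. \<xi> i x) {M..<m}\<bar> < e / 2"
          using small[of "n - M"] small[of "m - M"] shift[of "n - M"] shift[of "m - M"] that True by auto
        ultimately show ?thesis by (auto simp: abs_if split: if_splits)
      next
        case False then show ?thesis using \<open>0 < e\<close> by simp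
      qed
      then show ?thesis by blast
    qed
    then show ?case by (subst summable_Cauchy) blast
  qed
qed

text \<open>Integrating out the newest observation with the history held fixed is conditioning on
  the past: the history and the next observation are independent, so their joint law is a product
  and Fubini's theorem shows that the differences are centred.\<close>

theorem (in prob_space) innovations_summable_AE:
  fixes Y :: "nat \<Rightarrow> 'a \<Rightarrow> 'y" and \<phi> :: "nat \<Rightarrow> (nat \<Rightarrow> 'y) \<Rightarrow> 'y \<Rightarrow> real"
  assumes indep: "indep_vars (\<lambda>_. N) Y {1..}"
    and distr: "\<And>i. i \<ge> 1 \<Longrightarrow> distr M N (Y i) = Q"
    and \<phi>: "\<And>n. (\<lambda>(h, y). \<phi> n h y) \<in> borel_measurable (PiM {1..n} (\<lambda>_. N) \<Otimes>\<^sub>M N)"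
    and bound: "\<And>n h y. h \<in> space (PiM {1..n} (\<lambda>_. N)) \<Longrightarrow> y \<in> space N \<Longrightarrow> \<bar>\<phi> n h y\<bar> \<le> c n"
    and c: "summable (\<lambda>n. (c n)\<^sup>2)"
  shows "AE x in M. summable (\<lambda>n. \<phi> n (\<lambda>i\<in>{1..n}. Y i x) (Y (Suc n) x)
    - (\<integral>y. \<phi> n (\<lambda>i\<in>{1..n}. Y i x) y \<partial>Q))"
proof -
  let ?H = "\<lambda>n. PiM {1..n} (\<lambda>_::nat. N)"
  define H where "H n x = (\<lambda>i\<in>{1..n}. Y i x)" for n x
  \<comment> \<open>The filtration generated by the histories. Each of its sets is the preimage of a
    set of histories, which reduces centring to an integral over the joint law.\<close>
  define F where "F n = vimage_algebra (space M) (H n) (?H n)" for n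
  define \<Phi> where "\<Phi> n h = (\<integral>y. \<phi> n h y \<partial>Q)" for n h
  define \<xi> where "\<xi> n x = \<phi> n (H n x) (Y (Suc n) x) - \<Phi> n (H n x)" for n x
  have Y [measurable]: "Y i \<in> M \<rightarrow>\<^sub>M N" if "i \<ge> 1" for i
    using indep that by (auto simp: indep_vars_def)
  have sets_Q [measurable_cong]: "sets Q = sets N" using distr[of 1] by (auto simp flip: distr[of 1])
  have space_Q: "space Q = space N" using sets_eq_imp_space_eq[OF sets_Q] .
  interpret Q: prob_space Q
    unfolding distr[OF order_refl, symmetric] by (rule prob_space_distr) (rule Y, simp)
  have H [measurable]: "H n \<in> M \<rightarrow>\<^sub>M ?H n" for n
    unfolding H_def[abs_def] by (rule measurable_restrict) (auto intro: Y)
  have H_F: "H n \<in> F n \<rightarrow>\<^sub>M ?H n" for n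
    unfolding F_def by (rule measurable_vimage_algebra1) (use measurable_space[OF H] in auto)
  have sub: "subalgebra M (F n)" for n
    unfolding subalgebra_def F_def
    using measurable_sets[OF H, of _ n] measurable_space[OF H, of _ n]
    by (auto simp: sets_vimage_algebra2 Pi_iff)
  have H_Suc: "H n = (\<lambda>h. restrict h {1..n}) \<circ> H (Suc n)" for n
    by (auto simp: H_def fun_eq_iff restrict_def)
  have restr: "(\<lambda>h. restrict h {1..n}) \<in> ?H (Suc n) \<rightarrow>\<^sub>M ?H n" for n
    by (rule measurable_restrict_subset) auto
  have H_F_Suc: "H n \<in> F (Suc n) \<rightarrow>\<^sub>M ?H n" for n
    unfolding H_Suc[of n] by (rule measurable_comp[OF H_F restr])
  have Y_F: "Y (Suc n) \<in> F (Suc n) \<rightarrow>\<^sub>M N" for n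
  proof -
    have "(\<lambda>x. H (Suc n) x (Suc n)) \<in> F (Suc n) \<rightarrow>\<^sub>M N"
      by (rule measurable_compose[OF H_F measurable_component_singleton]) simp
    then show ?thesis by (simp add: H_def)
  qed
  have mono: "sets (F n) \<subseteq> sets (F (Suc n))" for n
  proof
    fix A assume "A \<in> sets (F n)"
    then obtain B where B: "B \<in> sets (?H n)" "A = H n -` B \<inter> space M"
      unfolding F_def using measurable_space[OF H, of _ n] by (auto simp: sets_vimage_algebra2 Pi_iff)
    have "H n -` B \<inter> space (F (Suc n)) \<in> sets (F (Suc n))" by (rule measurable_sets[OF H_F_Suc B(1)])
    then show "A \<in> sets (F (Suc n))" by (simp add: B(2) F_def)
  qed
  have \<Phi> [measurable]: "\<Phi> n \<in> borel_measurable (?H n)" for n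
    unfolding \<Phi>_def[abs_def]
    by (rule Q.borel_measurable_lebesgue_integral) (use \<phi>[of n] sets_Q in \<open>simp cong: measurable_cong_sets sets_pair_measure_cong\<close>)
  have \<phi>_pair: "(\<lambda>x. \<phi> n (f x) (g x)) \<in> borel_measurable L"
    if "f \<in> L \<rightarrow>\<^sub>M ?H n" "g \<in> L \<rightarrow>\<^sub>M N" for f g n and L :: "'l measure"
    using measurable_compose[OF measurable_Pair[OF that] \<phi>[of n]] by simp
  have \<Phi>_bound: "\<bar>\<Phi> n h\<bar> \<le> c n" if h: "h \<in> space (?H n)" for n h
  proof -
    have int: "integrable Q (\<phi> n h)"
      by (rule Q.integrable_const_bound[where B = "c n"])
        (use bound[OF h] h \<phi>_pair[of "\<lambda>_. h" Q n "\<lambda>y. y"] in \<open>auto simp: space_Q sets_Q\<close>)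
    have "\<bar>\<Phi> n h\<bar> \<le> (\<integral>y. \<bar>\<phi> n h y\<bar> \<partial>Q)" unfolding \<Phi>_def by (rule integral_abs_bound)
    also have "\<dots> \<le> (\<integral>y. c n \<partial>Q)"
      using int bound[OF h] by (intro integral_mono) (auto simp: space_Q)
    finally show ?thesis by (simp add: Q.prob_space)
  qed
  have H_space: "H n x \<in> space (?H n)" if "x \<in> space M" for n x
    using measurable_space[OF H that] .
  have Y_space: "Y (Suc n) x \<in> space N" if "x \<in> space M" for n x
    using measurable_space[OF Y that] by simp
  have "AE x in M. summable (\<lambda>n. \<xi> n x)"
  proof (rule martingale_summable_AE[where F = F and c = "\<lambda>n. 2 * c n"])
    show "\<xi> n \<in> borel_measurable (F (Suc n))" for n
      unfolding \<xi>_def[abs_def]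
      by (intro borel_measurable_diff \<phi>_pair H_F_Suc Y_F measurable_compose[OF H_F_Suc \<Phi>])
    show "\<bar>\<xi> n x\<bar> \<le> 2 * c n" if "x \<in> space M" for n x
      using bound[OF H_space[OF that, of n] Y_space[OF that, of n]] \<Phi>_bound[OF H_space[OF that], of n]
      unfolding \<xi>_def by linarith
    show "summable (\<lambda>n. (2 * c n)\<^sup>2)" using c by (simp add: power_mult_distrib summable_mult)
  next
    fix n A assume "A \<in> sets (F n)"
    then obtain B where B: "B \<in> sets (?H n)" "A = H n -` B \<inter> space M"
      unfolding F_def using measurable_space[OF H, of _ n] by (auto simp: sets_vimage_algebra2 Pi_iff)
    note B(1) [measurable]
    define g where "g = (\<lambda>(h, y). indicator B h * \<phi> n h y :: real)"
    have g [measurable]: "g \<in> borel_measurable (?H n \<Otimes>\<^sub>M N)"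
      unfolding g_def case_prod_beta
      by (intro borel_measurable_times \<phi>_pair) measurable
    let ?D = "distr M (?H n) (H n)"
    interpret D: prob_space ?D by (rule prob_space_distr) (rule H)
    interpret DQ: pair_prob_space ?D Q ..
    let ?K = "PiM {Suc n} (\<lambda>_::nat. N)"
    let ?R = "distr M ?K (\<lambda>x. \<lambda>i\<in>{Suc n}. Y i x)"
    \<comment> \<open>Independence of disjoint index blocks speaks of restricted families, so the
      next observation first appears as a family over a single index and is then projected to
      N.\<close>
    have "indep_var (?H n) (H n) (PiM {Suc n} (\<lambda>_. N)) (\<lambda>x. \<lambda>i\<in>{Suc n}. Y i x)"
      unfolding H_def by (rule indep_var_restrict[OF indep]) auto
    then have indep': "?D \<Otimes>\<^sub>M ?R = distr M (?H n \<Otimes>\<^sub>M ?K) (\<lambda>x. (H n x, \<lambda>i\<in>{Suc n}. Y i x))"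
      unfolding indep_var_distribution_eq by blast
    have K: "(\<lambda>x. \<lambda>i\<in>{Suc n}. Y i x) \<in> M \<rightarrow>\<^sub>M ?K"
      by (rule measurable_restrict) (auto intro: Y)
    have eval: "(\<lambda>z. z (Suc n)) \<in> ?K \<rightarrow>\<^sub>M N" by (rule measurable_component_singleton) simp
    have D_id: "distr ?D (?H n) (\<lambda>h. h) = ?D" by (rule distr_id2) simp
    have Q_eq: "distr ?R N (\<lambda>z. z (Suc n)) = Q"
      by (subst distr_distr[OF eval K]) (simp add: comp_def distr)
    have "?D \<Otimes>\<^sub>M Q = distr ?D (?H n) (\<lambda>h. h) \<Otimes>\<^sub>M distr ?R N (\<lambda>z. z (Suc n))"
      by (simp only: D_id Q_eq)
    also have "\<dots> = distr (?D \<Otimes>\<^sub>M ?R) (?H n \<Otimes>\<^sub>M N) (\<lambda>(h, z). (h, z (Suc n)))"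
      by (rule pair_measure_distr) (use eval in \<open>auto simp: Q_eq intro: Q.sigma_finite_measure_axioms\<close>)
    also have "\<dots> = distr M (?H n \<Otimes>\<^sub>M N) (\<lambda>x. (H n x, Y (Suc n) x))"
      unfolding indep'
    proof (subst distr_distr)
      show "(\<lambda>(h, z). (h, z (Suc n))) \<in> ?H n \<Otimes>\<^sub>M ?K \<rightarrow>\<^sub>M ?H n \<Otimes>\<^sub>M N"
        unfolding case_prod_beta
        by (intro measurable_Pair measurable_fst measurable_compose[OF measurable_snd eval])
      show "(\<lambda>x. (H n x, \<lambda>i\<in>{Suc n}. Y i x)) \<in> M \<rightarrow>\<^sub>M ?H n \<Otimes>\<^sub>M ?K"
        by (intro measurable_Pair H K)
    qed (simp add: comp_def)
    finally have joint: "distr M (?H n \<Otimes>\<^sub>M N) (\<lambda>x. (H n x, Y (Suc n) x)) = ?D \<Otimes>\<^sub>M Q" ..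
    have g_DQ: "g \<in> borel_measurable (?D \<Otimes>\<^sub>M Q)"
      using g sets_Q by (simp cong: measurable_cong_sets sets_pair_measure_cong)
    have c0: "0 \<le> c n"
      using bound[OF H_space Y_space] not_empty by (metis abs_ge_zero ex_in_conv order_trans)
    have int_g: "integrable (?D \<Otimes>\<^sub>M Q) g"
      by (rule DQ.integrable_const_bound[where B = "c n"])
        (use g_DQ bound[of _ n] c0 in \<open>auto simp: g_def space_pair_measure space_Q indicator_def intro!: AE_I2\<close>)
    have int1: "integrable M (\<lambda>x. indicator A x * \<phi> n (H n x) (Y (Suc n) x))"
      by (rule integrable_const_bound[where B = "c n"])
        (use bound[OF H_space Y_space] c0 \<phi>_pair[OF H Y[of "Suc n"], of n] B(2) in
          \<open>auto simp: indicator_def intro!: AE_I2\<close>)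
    have int2: "integrable M (\<lambda>x. indicator A x * \<Phi> n (H n x))"
      by (rule integrable_const_bound[where B = "c n"])
        (use \<Phi>_bound[OF H_space] c0 B(2) in \<open>auto simp: indicator_def intro!: AE_I2\<close>)
    have "(\<integral>x. indicator A x * \<phi> n (H n x) (Y (Suc n) x) \<partial>M) = (\<integral>x. g (H n x, Y (Suc n) x) \<partial>M)"
      by (intro Bochner_Integration.integral_cong refl) (simp add: g_def B(2) indicator_def)
    also have "\<dots> = (\<integral>z. g z \<partial>distr M (?H n \<Otimes>\<^sub>M N) (\<lambda>x. (H n x, Y (Suc n) x)))"
    proof (rule integral_distr[symmetric])
      show "(\<lambda>x. (H n x, Y (Suc n) x)) \<in> M \<rightarrow>\<^sub>M ?H n \<Otimes>\<^sub>M N"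
        by (intro measurable_Pair H Y) simp
    qed (rule g)
    also have "\<dots> = (\<integral>h. \<integral>y. g (h, y) \<partial>Q \<partial>?D)"
      unfolding joint by (rule DQ.integral_fst'[OF int_g, symmetric])
    also have "\<dots> = (\<integral>h. indicator B h * \<Phi> n h \<partial>?D)"
      by (simp add: g_def \<Phi>_def)
    also have "\<dots> = (\<integral>x. indicator B (H n x) * \<Phi> n (H n x) \<partial>M)"
      by (rule integral_distr[OF H]) measurable
    also have "\<dots> = (\<integral>x. indicator A x * \<Phi> n (H n x) \<partial>M)"
      by (intro Bochner_Integration.integral_cong refl) (simp add: B(2) indicator_def)
    finally have eq: "(\<integral>x. indicator A x * \<phi> n (H n x) (Y (Suc n) x) \<partial>M) =
      (\<integral>x. indicator A x * \<Phi> n (H n x) \<partial>M)" .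
    have "(\<integral>x\<in>A. \<xi> n x \<partial>M) =
        (\<integral>x. indicator A x * \<phi> n (H n x) (Y (Suc n) x) - indicator A x * \<Phi> n (H n x) \<partial>M)"
      by (simp add: set_lebesgue_integral_def \<xi>_def right_diff_distrib)
    also have "\<dots> = 0" using int1 int2 eq by simp
    finally show "(\<integral>x\<in>A. \<xi> n x \<partial>M) = 0" .
  qed (use sub mono in auto)
  then show ?thesis by (simp add: \<xi>_def \<Phi>_def H_def)
qed

section \<open>Minimizers of the divergence in the interior of the simplex\<close>

lemma prob_simplexD:
  assumes "f \<in> prob_simplex"
  shows "0 \<le> f $ u" "(\<Sum>u\<in>UNIV. f $ u) = 1" "f $ u \<le> 1"
proof -
  show 1: "0 \<le> f $ u" "(\<Sum>u\<in>UNIV. f $ u) = 1" for u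
    using assms by (auto simp: prob_simplex_def)
  show "f $ u \<le> 1"
    using member_le_sum[of u UNIV "\<lambda>u. f $ u"] 1 by simp
qed

lemma compact_prob_simplex: "compact (prob_simplex :: (real ^ 'u::finite) set)"
proof -
  have eq: "(prob_simplex :: (real ^ 'u) set) = {f. \<forall>u. 0 \<le> f $ u} \<inter> {f. (\<Sum>u\<in>UNIV. f $ u) = 1}"
    by (auto simp: prob_simplex_def)
  have "closed (prob_simplex :: (real ^ 'u) set)"
    unfolding eq
    by (intro closed_Int closed_Collect_all closed_Collect_le closed_Collect_eq continuous_intros)
  moreover have "bounded (prob_simplex :: (real ^ 'u) set)"
  proof (rule boundedI)
    fix f :: "real ^ 'u" assume f: "f \<in> prob_simplex"
    have "norm f \<le> (\<Sum>u\<in>UNIV. \<bar>f $ u\<bar>)" by (rule norm_le_l1_cart)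
    also have "\<dots> = 1" using prob_simplexD[OF f] by simp
    finally show "norm f \<le> 1" .
  qed
  ultimately show ?thesis by (simp add: compact_eq_bounded_closed)
qed

lemma mixture_nonneg: "(\<And>u. 0 \<le> p u y) \<Longrightarrow> (\<And>u. 0 \<le> f $ u) \<Longrightarrow> 0 \<le> mixture p f y"
  unfolding mixture_def by (intro sum_nonneg) auto

lemma mixture_pos:
  assumes "f \<in> prob_simplex" and p: "\<And>u. 0 < p u y"
  shows "0 < mixture p f y"
proof -
  have "\<exists>u. f $ u \<noteq> 0"
    using prob_simplexD(2)[OF assms(1)] by (metis sum.neutral zero_neq_one)
  then obtain u where u: "0 < f $ u" using prob_simplexD(1)[OF assms(1)] by (metis less_le)
  show ?thesis
    unfolding mixture_def
    by (rule sum_pos2[of _ u]) (use p u prob_simplexD(1)[OF assms(1)] in \<open>auto intro!: mult_nonneg_nonneg less_imp_le[OF p]\<close>)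
qed

lemma mixture_add: "mixture p (f + g) y = mixture p f y + mixture p g y"
  by (simp add: mixture_def sum.distrib distrib_left)

lemma mixture_scaleR: "mixture p (t *\<^sub>R f) y = t * mixture p f y"
  by (simp add: mixture_def sum_distrib_left mult_ac)

lemma mixture_axis: "mixture p (axis u 1) y = p u y"
  by (simp add: mixture_def axis_def if_distrib cong: if_cong)

lemma sum_scaleR_component: "(\<Sum>u\<in>UNIV. (t *\<^sub>R e :: real ^ 'u::finite) $ u) = t * (\<Sum>u\<in>UNIV. e $ u)"
  by (simp add: sum_distrib_left)

lemma component_le_mixture:
  assumes "\<And>u. 0 \<le> p u y" "\<And>u. 0 \<le> f $ u"
  shows "p u y * f $ u \<le> mixture p f y"
  unfolding mixture_def
  by (rule member_le_sum[of u UNIV "\<lambda>u. p u y * f $ u"]) (use assms in auto)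

lemma mixture_le:
  assumes f: "f \<in> prob_simplex" and "\<And>u. p u y \<le> b"
  shows "mixture p f y \<le> b"
proof -
  have "mixture p f y \<le> (\<Sum>u\<in>UNIV. b * f $ u)"
    unfolding mixture_def using assms prob_simplexD(1)[OF f] by (intro sum_mono mult_right_mono) auto
  also have "\<dots> = b" using prob_simplexD(2)[OF f] by (simp flip: sum_distrib_left)
  finally show ?thesis .
qed

lemma mixture_ge:
  assumes f: "f \<in> prob_simplex" and "\<And>u. b \<le> p u y"
  shows "b \<le> mixture p f y"
proof -
  have "b = (\<Sum>u\<in>UNIV. b * f $ u)" using prob_simplexD(2)[OF f] by (simp flip: sum_distrib_left)
  also have "\<dots> \<le> mixture p f y"
    unfolding mixture_def using assms prob_simplexD(1)[OF f] by (intro sum_mono mult_right_mono) auto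
  finally show ?thesis .
qed

lemma borel_measurable_mixture [measurable (raw)]:
  assumes "\<And>u. (\<lambda>x. p u (g x)) \<in> borel_measurable M" "F \<in> borel_measurable M"
  shows "(\<lambda>x. mixture p (F x) (g x)) \<in> borel_measurable M"
  unfolding mixture_def
  by (intro borel_measurable_sum borel_measurable_times assms
      measurable_compose[OF assms(2) borel_measurable_nth])

text \<open>Q is the law of one observation. The true density m itself has disappeared: only
  differences of divergences matter, and there it cancels, leaving \<open>ln (m_fs / m_f)\<close>.
  Integrability is demanded at the vertices of the simplex, where the mixture is a single
  \<open>p u\<close>; it propagates to all of the simplex.\<close>

locale interior_KL_minimizer = prob_space Q for Q :: "'y measure" +
  fixes p :: "'u::finite \<Rightarrow> 'y \<Rightarrow> real" and fs :: "real ^ 'u"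
  assumes p_meas [measurable]: "\<And>u. p u \<in> borel_measurable Q"
    and p_nonneg: "\<And>u y. y \<in> space Q \<Longrightarrow> 0 \<le> p u y"
    and p_pos: "AE y in Q. \<forall>u. 0 < p u y"
    and fs: "fs \<in> prob_simplex" and fs_pos: "\<And>u. 0 < fs $ u"
    and ln_integrable: "\<And>u. integrable Q (\<lambda>y. ln (mixture p fs y / p u y))"
    and KL_pos: "\<And>f. f \<in> prob_simplex \<Longrightarrow> f \<noteq> fs \<Longrightarrow>
      0 < (\<integral>y. ln (mixture p fs y / mixture p f y) \<partial>Q)"
begin

definition excess :: "real ^ 'u \<Rightarrow> real" where
  "excess f = (\<integral>y. ln (mixture p fs y / mixture p f y) \<partial>Q)"

definition envelope :: "'y \<Rightarrow> real" where
  "envelope y = (\<Sum>u\<in>UNIV. \<bar>ln (mixture p fs y / p u y)\<bar>)"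

lemma integrable_envelope: "integrable Q envelope"
  unfolding envelope_def by (intro Bochner_Integration.integrable_sum integrable_abs ln_integrable)

text \<open>\<open>m_f y\<close> is an average of the values \<open>p u y\<close>, hence lies
  between the smallest and the largest of them; the logarithm is thus caught between two terms of
  the envelope. One integrable function dominates for all f at once.\<close>

lemma abs_ln_ratio_le_envelope:
  assumes f: "f \<in> prob_simplex" and p: "\<And>u. 0 < p u y"
  shows "\<bar>ln (mixture p fs y / mixture p f y)\<bar> \<le> envelope y"
proof -
  have env: "\<bar>ln (mixture p fs y / p u y)\<bar> \<le> envelope y" for u
    unfolding envelope_def by (rule member_le_sum[of u UNIV "\<lambda>u. \<bar>ln (mixture p fs y / p u y)\<bar>"]) auto
  have pos: "0 < mixture p fs y" "0 < mixture p f y"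
    using mixture_pos[OF fs, of p y] mixture_pos[OF f, of p y] p by auto
  have "Max (range (\<lambda>v. p v y)) \<in> range (\<lambda>v. p v y)" by (rule Max_in) auto
  then obtain u where "p u y = Max (range (\<lambda>v. p v y))" by (metis rangeE)
  then have u: "\<And>v. p v y \<le> p u y" by simp
  have "Min (range (\<lambda>u. p u y)) \<in> range (\<lambda>u. p u y)" by (rule Min_in) auto
  then obtain v where "p v y = Min (range (\<lambda>u. p u y))" by (metis rangeE)
  then have v: "\<And>u. p v y \<le> p u y" by simp
  have "ln (mixture p fs y / p u y) \<le> ln (mixture p fs y / mixture p f y)"
    using mixture_le[OF f, of p y "p u y"] u pos p[of u] by (intro ln_mono) (auto intro!: divide_left_mono)
  moreover have "ln (mixture p fs y / mixture p f y) \<le> ln (mixture p fs y / p v y)"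
    using mixture_ge[OF f, of "p v y" p y] v pos p[of v] by (intro ln_mono) (auto intro!: divide_left_mono)
  ultimately show ?thesis using env[of u] env[of v] by linarith
qed

lemma integrable_ln_ratio:
  assumes "f \<in> prob_simplex"
  shows "integrable Q (\<lambda>y. ln (mixture p fs y / mixture p f y))"
proof (rule Bochner_Integration.integrable_bound[OF integrable_envelope])
  show "AE y in Q. norm (ln (mixture p fs y / mixture p f y)) \<le> norm (envelope y)"
    using p_pos
  proof eventually_elim
    case (elim y)
    then show ?case using abs_ln_ratio_le_envelope[OF assms, of y] by simp
  qed
qed measurable

lemma excess_fs [simp]: "excess fs = 0"
proof -
  have "excess fs = (\<integral>y. 0 \<partial>Q)"
    unfolding excess_def
  proof (rule integral_cong_AE)
    show "AE y in Q. ln (mixture p fs y / mixture p fs y) = 0"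
      using p_pos by eventually_elim (use mixture_pos[OF fs] in force)
  qed measurable
  then show ?thesis by simp
qed

lemma excess_nonneg: "f \<in> prob_simplex \<Longrightarrow> 0 \<le> excess f"
  using KL_pos[of f] by (cases "f = fs") (auto simp flip: excess_def)

lemma continuous_on_excess: "continuous_on prob_simplex excess"
  unfolding continuous_on_sequentially
proof (intro allI ballI impI)
  fix X :: "nat \<Rightarrow> real ^ 'u" and f
  assume f: "f \<in> prob_simplex" and "(\<forall>n. X n \<in> prob_simplex) \<and> X \<longlonglongrightarrow> f"
  then have X: "\<And>n. X n \<in> prob_simplex" "X \<longlonglongrightarrow> f" by auto
  show "(excess \<circ> X) \<longlonglongrightarrow> excess f"
    unfolding excess_def comp_def
  proof (rule integral_dominated_convergence[OF _ _ integrable_envelope])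
    show "AE y in Q. (\<lambda>n. ln (mixture p fs y / mixture p (X n) y)) \<longlonglongrightarrow> ln (mixture p fs y / mixture p f y)"
      using p_pos
    proof eventually_elim
      case (elim y)
      have "0 < mixture p fs y" "0 < mixture p f y"
        using mixture_pos[OF fs, of p y] mixture_pos[OF f, of p y] elim by auto
      moreover have "(\<lambda>n. mixture p (X n) y) \<longlonglongrightarrow> mixture p f y"
        unfolding mixture_def by (intro tendsto_intros X)
      ultimately show ?case by (intro tendsto_intros) auto
    qed
    show "AE y in Q. norm (ln (mixture p fs y / mixture p (X n) y)) \<le> envelope y" for n
      using p_pos
    proof eventually_elim
      case (elim y)
      then show ?case using abs_ln_ratio_le_envelope[OF X(1), of y n] by simp
    qed
  qed measurable
qed

text \<open>The excess is continuous and strictly positive off \<open>fs\<close>, so compactness of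
  the simplex without a ball turns uniqueness into a uniform gap.\<close>

lemma excess_separated:
  assumes "0 < r"
  obtains \<kappa> where "0 < \<kappa>" "\<And>f. f \<in> prob_simplex \<Longrightarrow> r \<le> norm (f - fs) \<Longrightarrow> \<kappa> \<le> excess f"
proof -
  let ?S = "prob_simplex \<inter> {f. r \<le> norm (f - fs)}"
  have comp: "compact ?S"
    by (intro compact_Int_closed compact_prob_simplex closed_Collect_le continuous_intros)
  show ?thesis
  proof (cases "?S = {}")
    case True
    then show ?thesis using that[of 1] by auto
  next
    case False
    have "continuous_on ?S excess" by (rule continuous_on_subset[OF continuous_on_excess]) auto
    from continuous_attains_inf[OF comp False this]
    obtain g where g: "g \<in> ?S" "\<And>f. f \<in> ?S \<Longrightarrow> excess g \<le> excess f" by auto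
    have "g \<noteq> fs" using g(1) assms by auto
    then have "0 < excess g" using KL_pos[of g] g(1) by (simp add: excess_def)
    with g show ?thesis using that[of "excess g"] by auto
  qed
qed

section \<open>Score, stationarity and Fisher information at the minimizer\<close>

definition score :: "real ^ 'u \<Rightarrow> 'y \<Rightarrow> real" where
  "score e y = mixture p e y / mixture p fs y"

definition fs_inv_sum :: real where
  "fs_inv_sum = (\<Sum>u\<in>UNIV. 1 / fs $ u)"

lemma fs_inv_le: "1 / fs $ u \<le> fs_inv_sum"
  unfolding fs_inv_sum_def
  by (rule member_le_sum[of u UNIV "\<lambda>u. 1 / fs $ u"]) (use fs_pos in \<open>auto intro: less_imp_le\<close>)

lemma fs_inv_sum_ge_1: "1 \<le> fs_inv_sum"
proof -
  fix u
  have "1 \<le> 1 / fs $ u" using fs_pos[of u] prob_simplexD(3)[OF fs, of u] by simp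
  then show ?thesis using fs_inv_le[of u] by linarith
qed

text \<open>\<open>fs u * p u y\<close> is one of the nonnegative terms of \<open>m_fs y\<close>, so
  interiority of \<open>fs\<close> bounds the ratios. All moments needed near \<open>fs\<close> come
  from here. Where the mixture vanishes, the quotient is 0 by convention.\<close>

lemma ratio_bounds:
  assumes "y \<in> space Q"
  shows "0 \<le> p u y / mixture p fs y" "p u y / mixture p fs y \<le> 1 / fs $ u"
proof -
  have m: "0 \<le> mixture p fs y"
    by (rule mixture_nonneg) (use assms p_nonneg prob_simplexD[OF fs] in auto)
  show "0 \<le> p u y / mixture p fs y" using m p_nonneg[OF assms] by simp
  show "p u y / mixture p fs y \<le> 1 / fs $ u"
  proof (cases "mixture p fs y = 0")
    case True
    then show ?thesis using fs_pos[of u] by simp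
  next
    case False
    have "p u y * fs $ u \<le> mixture p fs y"
      by (rule component_le_mixture) (use assms p_nonneg prob_simplexD[OF fs] in auto)
    then show ?thesis using False m fs_pos[of u] by (simp add: field_simps)
  qed
qed

lemma score_eq: "score e y = (\<Sum>u\<in>UNIV. e $ u * (p u y / mixture p fs y))"
  by (simp add: score_def mixture_def[of p e] sum_divide_distrib mult_ac)

lemma score_scaleR: "score (t *\<^sub>R e) y = t * score e y"
  by (simp add: score_def mixture_scaleR)

lemma score_measurable [measurable]: "score e \<in> borel_measurable Q"
  unfolding score_def[abs_def] by measurable

lemma abs_score_le:
  assumes "y \<in> space Q"
  shows "\<bar>score e y\<bar> \<le> fs_inv_sum * norm e"
proof -
  have "\<bar>score e y\<bar> \<le> (\<Sum>u\<in>UNIV. \<bar>e $ u * (p u y / mixture p fs y)\<bar>)"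
    unfolding score_eq by (rule sum_abs)
  also have "\<dots> \<le> (\<Sum>u\<in>UNIV. norm e * (1 / fs $ u))"
  proof (intro sum_mono)
    fix u
    have "\<bar>p u y / mixture p fs y\<bar> \<le> 1 / fs $ u" using ratio_bounds[OF assms, of u] by simp
    then show "\<bar>e $ u * (p u y / mixture p fs y)\<bar> \<le> norm e * (1 / fs $ u)"
      unfolding abs_mult by (intro mult_mono component_le_norm_cart) auto
  qed
  also have "\<dots> = fs_inv_sum * norm e" by (simp add: fs_inv_sum_def sum_distrib_right)
  finally show ?thesis .
qed

lemma integrable_ratio: "integrable Q (\<lambda>y. p u y / mixture p fs y)"
proof (rule integrable_const_bound[where B = "1 / fs $ u"])
  show "AE y in Q. norm (p u y / mixture p fs y) \<le> 1 / fs $ u"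
  proof (rule AE_I2)
    fix y assume "y \<in> space Q"
    from ratio_bounds[OF this, of u] show "norm (p u y / mixture p fs y) \<le> 1 / fs $ u" by simp
  qed
qed measurable

lemma integrable_score: "integrable Q (score e)"
  by (rule integrable_const_bound[where B = "fs_inv_sum * norm e"]) (use abs_score_le in auto)

lemma integrable_score_sq: "integrable Q (\<lambda>y. (score e y)\<^sup>2)"
proof (rule integrable_const_bound[where B = "(fs_inv_sum * norm e)\<^sup>2"])
  show "AE y in Q. norm ((score e y)\<^sup>2) \<le> (fs_inv_sum * norm e)\<^sup>2"
  proof (rule AE_I2)
    fix y assume "y \<in> space Q"
    from power_mono[OF abs_score_le[OF this, of e] abs_ge_zero, of 2]
    show "norm ((score e y)\<^sup>2) \<le> (fs_inv_sum * norm e)\<^sup>2" by simp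
  qed
qed measurable

lemma mixture_shift:
  assumes "mixture p fs y \<noteq> 0"
  shows "mixture p (fs + e) y = mixture p fs y * (1 + score e y)"
  using assms by (simp add: score_def mixture_add distrib_left)

lemma shift_in_simplex:
  assumes e: "(\<Sum>u\<in>UNIV. e $ u) = 0" and small: "fs_inv_sum * norm e \<le> 1"
  shows "fs + e \<in> prob_simplex"
proof -
  have "0 \<le> fs $ u + e $ u" for u
  proof -
    have "1 / fs $ u * norm e \<le> 1"
      using mult_right_mono[OF fs_inv_le[of u], of "norm e"] small by simp
    then have "norm e \<le> fs $ u" using fs_pos[of u] by (simp add: field_simps)
    then show ?thesis using component_le_norm_cart[of e u] by (simp add: abs_le_iff)
  qed
  then show ?thesis using e prob_simplexD(2)[OF fs] by (simp add: prob_simplex_def sum.distrib)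
qed

lemma excess_shift:
  "excess (fs + e) = - (\<integral>y. ln (1 + score e y) \<partial>Q)" if "fs_inv_sum * norm e < 1"
proof -
  have "excess (fs + e) = (\<integral>y. - ln (1 + score e y) \<partial>Q)"
    unfolding excess_def
  proof (rule integral_cong_AE)
    show "AE y in Q. ln (mixture p fs y / mixture p (fs + e) y) = - ln (1 + score e y)"
      using p_pos AE_space
    proof eventually_elim
      case (elim y)
      have m: "0 < mixture p fs y" using mixture_pos[OF fs, of p y] elim by auto
      moreover have "0 < 1 + score e y" using abs_score_le[OF elim(2), of e] that by linarith
      ultimately show ?case by (simp add: mixture_shift ln_div ln_mult)
    qed
  qed measurable
  then show ?thesis by simp
qed

text \<open>The first-order condition. For small t of either sign \<open>fs + t e\<close> stays in
  the simplex and has nonnegative excess; with \<open>ln (1 + x) \<ge> x - 2 x\<^sup>2\<close> this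
  bounds t times the mean score by a multiple of \<open>t\<^sup>2\<close>. Dividing by t and letting
  it tend to 0 forces the mean to vanish.\<close>

lemma integral_score_eq_0:
  assumes e: "(\<Sum>u\<in>UNIV. e $ u) = 0"
  shows "(\<integral>y. score e y \<partial>Q) = 0"
proof -
  define b where "b = fs_inv_sum * norm e"
  have b: "0 \<le> b" using fs_inv_sum_ge_1 by (simp add: b_def)
  have *: "t * (\<integral>y. score e y \<partial>Q) \<le> 2 * (t * b)\<^sup>2" if t: "\<bar>t\<bar> * b \<le> 1 / 2" for t
  proof -
    note sc = score_scaleR
    have nb: "fs_inv_sum * norm (t *\<^sub>R e) = \<bar>t\<bar> * b" by (simp add: b_def)
    have small: "\<bar>t * score e y\<bar> \<le> \<bar>t\<bar> * b" if "y \<in> space Q" for y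
      using abs_score_le[OF that, of "t *\<^sub>R e"] unfolding sc nb .
    have "fs + t *\<^sub>R e \<in> prob_simplex"
    proof (rule shift_in_simplex)
      show "(\<Sum>u\<in>UNIV. (t *\<^sub>R e) $ u) = 0" unfolding sum_scaleR_component e by simp
      show "fs_inv_sum * norm (t *\<^sub>R e) \<le> 1" using nb t by linarith
    qed
    then have "0 \<le> excess (fs + t *\<^sub>R e)" by (rule excess_nonneg)
    also have "\<dots> = - (\<integral>y. ln (1 + t * score e y) \<partial>Q)"
      unfolding sc[symmetric] by (rule excess_shift) (use t nb in linarith)
    finally have 0: "(\<integral>y. ln (1 + t * score e y) \<partial>Q) \<le> 0" by simp
    \<comment> \<open>The quadratic lower bound is what gets integrated; the crude upper bound
      serves only the integrability of the logarithm.\<close>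
    have ge: "t * score e y - 2 * (t * b)\<^sup>2 \<le> ln (1 + t * score e y)"
      and le: "ln (1 + t * score e y) \<le> t * b \<or> ln (1 + t * score e y) \<le> \<bar>t\<bar> * b"
      if "y \<in> space Q" for y
    proof -
      have "\<bar>t * score e y\<bar> \<le> 1 / 2" using small[OF that] t by simp
      from abs_ln_one_plus_x_minus_x_bound[OF this]
      have "t * score e y - 2 * (t * score e y)\<^sup>2 \<le> ln (1 + t * score e y)" by linarith
      moreover have "(t * score e y)\<^sup>2 \<le> (t * b)\<^sup>2"
        using power_mono[OF small[OF that] abs_ge_zero, of 2] by (simp add: power_mult_distrib)
      ultimately show "t * score e y - 2 * (t * b)\<^sup>2 \<le> ln (1 + t * score e y)" by linarith
      have "ln (1 + t * score e y) \<le> t * score e y"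
        using \<open>\<bar>t * score e y\<bar> \<le> 1 / 2\<close> by (intro ln_add_one_self_le_self2) auto
      then show "ln (1 + t * score e y) \<le> t * b \<or> ln (1 + t * score e y) \<le> \<bar>t\<bar> * b"
        using small[OF that] by linarith
    qed
    have int: "integrable Q (\<lambda>y. ln (1 + t * score e y))"
    proof (rule integrable_const_bound[where B = "\<bar>t\<bar> * b + 2 * (t * b)\<^sup>2"])
      show "AE y in Q. norm (ln (1 + t * score e y)) \<le> \<bar>t\<bar> * b + 2 * (t * b)\<^sup>2"
      proof (rule AE_I2)
        fix y assume y: "y \<in> space Q"
        have "t * b \<le> \<bar>t\<bar> * b" using b by (intro mult_right_mono) auto
        moreover have "0 \<le> (t * b)\<^sup>2" by simp
        ultimately show "norm (ln (1 + t * score e y)) \<le> \<bar>t\<bar> * b + 2 * (t * b)\<^sup>2"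
          using ge[OF y] le[OF y] small[OF y] unfolding real_norm_def by linarith
      qed
    qed measurable
    have "(\<integral>y. t * score e y - 2 * (t * b)\<^sup>2 \<partial>Q) \<le> (\<integral>y. ln (1 + t * score e y) \<partial>Q)"
      by (rule integral_mono) (use integrable_score int ge in auto)
    with 0 integrable_score[of e] show ?thesis by (simp add: prob_space)
  qed
  define I where "I = (\<integral>y. score e y \<partial>Q)"
  have bound: "\<bar>I\<bar> \<le> 2 * t * b\<^sup>2" if t: "0 < t" "t * b \<le> 1 / 2" for t
  proof -
    have "t * I \<le> t * (2 * t * b\<^sup>2)" "t * (- I) \<le> t * (2 * t * b\<^sup>2)"
      using *[of t] *[of "- t"] t by (simp_all add: I_def power2_eq_square mult_ac)
    then have "I \<le> 2 * t * b\<^sup>2" "- I \<le> 2 * t * b\<^sup>2"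
      using mult_le_cancel_left_pos[OF t(1)] by blast+
    then show ?thesis by linarith
  qed
  have "I = 0"
  proof (rule ccontr)
    assume "I \<noteq> 0"
    have "((\<lambda>t. 2 * t * b\<^sup>2) \<longlongrightarrow> 2 * 0 * b\<^sup>2) (at_right 0)" by (intro tendsto_intros)
    then have "\<forall>\<^sub>F t in at_right 0. 2 * t * b\<^sup>2 < \<bar>I\<bar>"
      using \<open>I \<noteq> 0\<close> by (intro order_tendstoD) auto
    moreover have "((\<lambda>t. t * b) \<longlongrightarrow> 0 * b) (at_right 0)" by (intro tendsto_intros)
    then have "\<forall>\<^sub>F t in at_right 0. t * b < 1 / 2" by (intro order_tendstoD) auto
    moreover have "\<forall>\<^sub>F t::real in at_right 0. 0 < t" by (simp add: eventually_at_right_less)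
    ultimately have "\<forall>\<^sub>F t::real in at_right 0. False"
      by eventually_elim (use bound in force)
    then show False by simp
  qed
  then show ?thesis by (simp add: I_def)
qed

text \<open>The segment from \<open>fs\<close> to the vertex u is a tangent direction with score
  \<open>p u / m_fs - 1\<close>. In other words, the mean field of the recursion vanishes at
  \<open>fs\<close>.\<close>

lemma integral_ratio_eq_1: "(\<integral>y. p u y / mixture p fs y \<partial>Q) = 1"
proof -
  let ?e = "axis u 1 - fs"
  have "(\<Sum>v\<in>UNIV. ?e $ v) = 0"
    using prob_simplexD(2)[OF fs] by (simp add: sum_subtractf axis_def)
  then have "0 = (\<integral>y. score ?e y \<partial>Q)" by (simp add: integral_score_eq_0)
  also have "\<dots> = (\<integral>y. p u y / mixture p fs y - 1 \<partial>Q)"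
  proof (rule integral_cong_AE)
    show "AE y in Q. score ?e y = p u y / mixture p fs y - 1"
      using p_pos
    proof eventually_elim
      case (elim y)
      have "0 < mixture p fs y" using mixture_pos[OF fs, of p y] elim by auto
      moreover have "mixture p ?e y = p u y - mixture p fs y"
        using mixture_add[of p ?e fs y] by (simp add: mixture_axis)
      ultimately show ?case by (simp add: score_def diff_divide_distrib)
    qed
  qed measurable
  also have "\<dots> = (\<integral>y. p u y / mixture p fs y \<partial>Q) - 1"
    using integrable_ratio by (simp add: prob_space)
  finally show ?thesis by simp
qed

text \<open>A degenerate direction of the Fisher information would leave the mixture, hence the
  divergence, unchanged, against the uniqueness of the minimizer.\<close>

lemma fisher_information_coercive:
  obtains \<mu> where "0 < \<mu>" "\<And>e. (\<Sum>u\<in>UNIV. e $ u) = 0 \<Longrightarrow> \<mu> * (norm e)\<^sup>2 \<le> (\<integral>y. (score e y)\<^sup>2 \<partial>Q)"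
proof -
  define H where "H e = (\<integral>y. (score e y)\<^sup>2 \<partial>Q)" for e
  define k where "k u v y = (p u y / mixture p fs y) * (p v y / mixture p fs y)" for u v y
  define h where "h u v = (\<integral>y. k u v y \<partial>Q)" for u v
  have int: "integrable Q (k u v)" for u v
    unfolding k_def
  proof (rule integrable_const_bound[where B = "1 / fs $ u * (1 / fs $ v)"])
    show "AE y in Q. norm (p u y / mixture p fs y * (p v y / mixture p fs y)) \<le> 1 / fs $ u * (1 / fs $ v)"
    proof (rule AE_I2)
      fix y assume y: "y \<in> space Q"
      have "\<bar>p u y / mixture p fs y\<bar> \<le> 1 / fs $ u" "\<bar>p v y / mixture p fs y\<bar> \<le> 1 / fs $ v"
        using ratio_bounds[OF y] by (simp_all add: abs_of_nonneg del: abs_divide)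
      then show "norm (p u y / mixture p fs y * (p v y / mixture p fs y)) \<le> 1 / fs $ u * (1 / fs $ v)"
        unfolding real_norm_def abs_mult by (rule mult_mono) (use fs_pos[of u] in auto)
    qed
  qed measurable
  \<comment> \<open>Expanding the square exhibits H as a quadratic form in finitely many
    coordinates; continuity follows, and with it a minimum on the compact unit sphere of the tangent
    space.\<close>
  have H_eq: "H e = (\<Sum>u\<in>UNIV. \<Sum>v\<in>UNIV. e $ u * e $ v * h u v)" for e
  proof -
    have "H e = (\<integral>y. (\<Sum>u\<in>UNIV. \<Sum>v\<in>UNIV. e $ u * e $ v * k u v y) \<partial>Q)"
      unfolding H_def
    proof (intro Bochner_Integration.integral_cong refl)
      fix y
      show "(score e y)\<^sup>2 = (\<Sum>u\<in>UNIV. \<Sum>v\<in>UNIV. e $ u * e $ v * k u v y)"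
        unfolding k_def score_eq power2_eq_square sum_product by (intro sum.cong refl) simp
    qed
    also have "\<dots> = (\<Sum>u\<in>UNIV. \<Sum>v\<in>UNIV. e $ u * e $ v * h u v)"
      using int by (simp add: h_def Bochner_Integration.integral_sum Bochner_Integration.integrable_sum)
    finally show ?thesis .
  qed
  have cont: "continuous_on S H" for S
    unfolding H_eq[abs_def] by (intro continuous_intros)
  have scale: "H (t *\<^sub>R e) = t\<^sup>2 * H e" for t e
    by (simp add: H_def score_scaleR power_mult_distrib)
  let ?S = "{e :: real ^ 'u. norm e = 1} \<inter> {e. (\<Sum>u\<in>UNIV. e $ u) = 0}"
  have "{e :: real ^ 'u. norm e = 1} = sphere 0 1" by (auto simp: sphere_def)
  then have comp: "compact ?S"
    by (auto intro!: compact_Int_closed closed_Collect_eq continuous_intros)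
  have pos: "0 < H e" if e: "e \<in> ?S" for e
  proof (rule ccontr)
    assume "\<not> 0 < H e"
    moreover have "0 \<le> H e" unfolding H_def by (intro integral_nonneg_AE) auto
    ultimately have "H e = 0" by simp
    then have ae: "AE y in Q. (score e y)\<^sup>2 = 0"
      unfolding H_def by (subst (asm) integral_nonneg_eq_0_iff_AE[OF integrable_score_sq]) auto
    \<comment> \<open>This length keeps \<open>fs + t e\<close> inside the simplex and is below the
      bound under which the excess is an integral of \<open>ln (1 + score)\<close>. A score that
      vanishes almost everywhere then gives a second point with excess 0.\<close>
    define t where "t = 1 / (2 * fs_inv_sum)"
    have t: "0 < t" using fs_inv_sum_ge_1 by (simp add: t_def)
    have tb: "fs_inv_sum * norm (t *\<^sub>R e) = 1 / 2"
      using e fs_inv_sum_ge_1 by (simp add: t_def)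
    have in_simplex: "fs + t *\<^sub>R e \<in> prob_simplex"
    proof (rule shift_in_simplex)
      show "(\<Sum>u\<in>UNIV. (t *\<^sub>R e) $ u) = 0" using e unfolding sum_scaleR_component by simp
      show "fs_inv_sum * norm (t *\<^sub>R e) \<le> 1" using tb by linarith
    qed
    have "excess (fs + t *\<^sub>R e) = - (\<integral>y. ln (1 + score (t *\<^sub>R e) y) \<partial>Q)"
      by (rule excess_shift) (use tb in linarith)
    also have "(\<integral>y. ln (1 + score (t *\<^sub>R e) y) \<partial>Q) = (\<integral>y. 0 \<partial>Q)"
    proof (rule integral_cong_AE)
      show "AE y in Q. ln (1 + score (t *\<^sub>R e) y) = 0"
        using ae
      proof eventually_elim
        case (elim y)
        then show ?case by (simp add: score_scaleR)
      qed
    qed measurable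
    finally have "excess (fs + t *\<^sub>R e) = 0" by simp
    moreover have "fs + t *\<^sub>R e \<noteq> fs" using t e by auto
    ultimately show False using KL_pos[OF in_simplex] by (simp add: excess_def)
  qed
  have lower: "\<exists>\<mu>>0. \<forall>e\<in>?S. \<mu> \<le> H e"
  proof (cases "?S = {}")
    case True
    then show ?thesis by (intro exI[of _ 1]) auto
  next
    case False
    from continuous_attains_inf[OF comp False cont] pos show ?thesis by blast
  qed
  then obtain \<mu> where \<mu>: "0 < \<mu>" "\<And>e. e \<in> ?S \<Longrightarrow> \<mu> \<le> H e" by blast
  have "\<mu> * (norm e)\<^sup>2 \<le> H e" if e: "(\<Sum>u\<in>UNIV. e $ u) = 0" for e
  proof (cases "e = 0")
    case True
    then show ?thesis by (simp add: H_eq)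
  next
    case False
    let ?e = "(1 / norm e) *\<^sub>R e"
    have "(\<Sum>u\<in>UNIV. ?e $ u) = 0" unfolding sum_scaleR_component e by simp
    then have "?e \<in> ?S" using False by simp
    then have "\<mu> * (norm e)\<^sup>2 \<le> H ?e * (norm e)\<^sup>2" by (intro mult_right_mono \<mu>) auto
    also have "\<dots> = H e" using False by (simp add: scale power_divide)
    finally show ?thesis .
  qed
  with \<mu>(1) show ?thesis using that unfolding H_def by blast
qed

section \<open>The mean field of the recursion near the minimizer\<close>

definition drift :: "real ^ 'u \<Rightarrow> real ^ 'u" where
  "drift f = (\<chi> u. f $ u * ((\<integral>y. p u y / mixture p f y \<partial>Q) - 1))"

text \<open>Write \<open>e = f - fs\<close>, q for its score and A for the second factor of the
  drift. Since \<open>f u = fs u + e u\<close>, the weighted inner product is the sum of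
  \<open>e u * A u\<close> plus a remainder. The first sum is minus the integral of
  \<open>q\<^sup>2 / (1 + q)\<close>, comparable to the Fisher information; the remainder is cubic
  in e because A is of order e.\<close>

lemma local_drift:
  obtains \<rho> c C where "0 < \<rho>" "0 < c"
    "\<And>f. f \<in> prob_simplex \<Longrightarrow> norm (f - fs) < \<rho> \<Longrightarrow>
      (\<Sum>u\<in>UNIV. (f - fs) $ u * drift f $ u / fs $ u) \<le> - c * (norm (f - fs))\<^sup>2"
    "\<And>f. f \<in> prob_simplex \<Longrightarrow> norm (f - fs) < \<rho> \<Longrightarrow> norm (drift f) \<le> C * norm (f - fs)"
proof -
  obtain \<mu> where \<mu>: "0 < \<mu>"
    "\<And>e. (\<Sum>u\<in>UNIV. e $ u) = 0 \<Longrightarrow> \<mu> * (norm e)\<^sup>2 \<le> (\<integral>y. (score e y)\<^sup>2 \<partial>Q)"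
    by (rule fisher_information_coercive) blast
  define b where "b = fs_inv_sum"
  have b: "1 \<le> b" using fs_inv_sum_ge_1 by (simp add: b_def)
  \<comment> \<open>The first bound keeps \<open>1 + q\<close> between 1/2 and 3/2. The second makes
    the cubic remainder, at most \<open>2 * b ^ 3\<close> times the cubed norm, cost no more than
    \<mu>/4 of the \<mu>/2 provided by the Fisher information.\<close>
  define \<rho> where "\<rho> = min (1 / (2 * b)) (\<mu> / (8 * b ^ 3))"
  have \<rho>: "0 < \<rho>" using b \<mu>(1) by (simp add: \<rho>_def)
  have main: "(\<Sum>u\<in>UNIV. (f - fs) $ u * drift f $ u / fs $ u) \<le> - (\<mu> / 4) * (norm (f - fs))\<^sup>2 \<and>
      norm (drift f) \<le> real CARD('u) * (2 * b\<^sup>2) * norm (f - fs)"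
    if f: "f \<in> prob_simplex" and near: "norm (f - fs) < \<rho>" for f
  proof -
    define e where "e = f - fs"
    define q where "q = score e"
    have f_eq: "f = fs + e" by (simp add: e_def)
    have e0: "(\<Sum>u\<in>UNIV. e $ u) = 0"
      using prob_simplexD(2)[OF f] prob_simplexD(2)[OF fs] by (simp add: e_def sum_subtractf)
    have ne: "norm e < 1 / (2 * b)" "norm e < \<mu> / (8 * b ^ 3)"
      using near by (auto simp: e_def \<rho>_def)
    have be: "b * norm e \<le> 1 / 2" using ne(1) b by (simp add: field_simps)
    have qb: "\<bar>q y\<bar> \<le> b * norm e" if "y \<in> space Q" for y
      unfolding q_def b_def by (rule abs_score_le[OF that])
    have q1: "1 / 2 \<le> 1 + q y" "1 + q y \<le> 3 / 2" if "y \<in> space Q" for y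
      using qb[OF that] be by linarith+
    have [measurable]: "q \<in> borel_measurable Q" unfolding q_def by measurable
    let ?r = "\<lambda>u y. p u y / mixture p fs y"
    have rb: "\<bar>?r u y\<bar> \<le> b" if "y \<in> space Q" for u y
      using ratio_bounds[OF that, of u] fs_inv_le[of u] by (simp add: b_def)
    have frac: "\<bar>q y / (1 + q y)\<bar> \<le> 2 * (b * norm e)" if y: "y \<in> space Q" for y
    proof -
      have "\<bar>q y\<bar> / \<bar>1 + q y\<bar> \<le> (b * norm e) / (1 / 2)"
        using qb[OF y] q1[OF y] by (intro frac_le) auto
      then show ?thesis by (simp add: abs_divide)
    qed
    define k where "k u y = ?r u y * (q y / (1 + q y))" for u y
    have kb: "\<bar>k u y\<bar> \<le> b * (2 * (b * norm e))" if "y \<in> space Q" for u y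
      unfolding k_def abs_mult using b by (intro mult_mono rb frac that) auto
    have int_k: "integrable Q (k u)" for u
      by (rule integrable_const_bound[where B = "b * (2 * (b * norm e))"])
        (use kb in \<open>auto simp: k_def[abs_def]\<close>)
    define A where "A u = (\<integral>y. p u y / mixture p f y \<partial>Q) - 1" for u
    \<comment> \<open>With ?r the ratio at \<open>fs\<close>, the ratio at f is
      \<open>?r / (1 + q) = ?r - ?r * q / (1 + q)\<close>, and ?r has mean 1.\<close>
    have A: "A u = - (\<integral>y. k u y \<partial>Q)" for u
    proof -
      have "(\<integral>y. p u y / mixture p f y \<partial>Q) = (\<integral>y. ?r u y - k u y \<partial>Q)"
      proof (rule integral_cong_AE)
        show "AE y in Q. p u y / mixture p f y = ?r u y - k u y"
          using p_pos AE_space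
        proof eventually_elim
          case (elim y)
          have m: "0 < mixture p fs y" using mixture_pos[OF fs, of p y] elim by auto
          have "mixture p f y = mixture p fs y * (1 + q y)"
            unfolding f_eq q_def by (rule mixture_shift) (use m in simp)
          moreover have "1 + q y \<noteq> 0" using q1(1)[OF elim(2)] by linarith
          ultimately show ?case using m by (simp add: k_def divide_simps) (simp add: algebra_simps)
        qed
      qed (auto simp: k_def)
      also have "\<dots> = 1 - (\<integral>y. k u y \<partial>Q)"
        using integrable_ratio int_k integral_ratio_eq_1 by simp
      finally show ?thesis by (simp add: A_def)
    qed
    have A_bound: "\<bar>A u\<bar> \<le> 2 * b\<^sup>2 * norm e" for u
    proof -
      have "\<bar>\<integral>y. k u y \<partial>Q\<bar> \<le> (\<integral>y. \<bar>k u y\<bar> \<partial>Q)" by (rule integral_abs_bound)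
      also have "\<dots> \<le> (\<integral>y. b * (2 * (b * norm e)) \<partial>Q)"
        using int_k kb by (intro integral_mono) auto
      finally show ?thesis by (simp add: A prob_space power2_eq_square mult_ac)
    qed
    have d: "drift f $ u = f $ u * A u" for u by (simp add: drift_def A_def)
    have first: "(\<Sum>u\<in>UNIV. e $ u * A u) \<le> - (\<mu> / 2) * (norm e)\<^sup>2"
    proof -
      have int_q2: "integrable Q (\<lambda>y. q y * (q y / (1 + q y)))"
        by (rule integrable_const_bound[where B = "(b * norm e) * (2 * (b * norm e))"])
          (use qb frac b in \<open>auto simp: abs_mult simp del: abs_divide times_divide_eq_right intro!: mult_mono\<close>)
      have "(\<Sum>u\<in>UNIV. e $ u * A u) = - (\<integral>y. (\<Sum>u\<in>UNIV. e $ u * k u y) \<partial>Q)"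
        using int_k by (simp add: A sum_negf)
      also have "(\<integral>y. (\<Sum>u\<in>UNIV. e $ u * k u y) \<partial>Q) = (\<integral>y. q y * (q y / (1 + q y)) \<partial>Q)"
        unfolding k_def mult.assoc[symmetric] sum_distrib_right[symmetric] q_def score_eq[symmetric] ..
      finally have eq: "(\<Sum>u\<in>UNIV. e $ u * A u) = - (\<integral>y. q y * (q y / (1 + q y)) \<partial>Q)" .
      have "(\<integral>y. (q y)\<^sup>2 / 2 \<partial>Q) \<le> (\<integral>y. q y * (q y / (1 + q y)) \<partial>Q)"
      proof (rule integral_mono)
        fix y assume y: "y \<in> space Q"
        have "(q y)\<^sup>2 / 2 \<le> (q y)\<^sup>2 / (1 + q y)"
          using q1[OF y] by (intro divide_left_mono) auto
        then show "(q y)\<^sup>2 / 2 \<le> q y * (q y / (1 + q y))" by (simp add: power2_eq_square)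
      qed (use integrable_score_sq int_q2 in \<open>auto simp: q_def\<close>)
      then have "(\<Sum>u\<in>UNIV. e $ u * A u) \<le> - ((\<integral>y. (q y)\<^sup>2 \<partial>Q) / 2)" unfolding eq by simp
      then show ?thesis using \<mu>(2)[OF e0] by (simp add: q_def)
    qed
    have second: "(\<Sum>u\<in>UNIV. (e $ u)\<^sup>2 / fs $ u * A u) \<le> (\<mu> / 4) * (norm e)\<^sup>2"
    proof -
      have "(\<Sum>u\<in>UNIV. (e $ u)\<^sup>2 / fs $ u * A u) \<le>
          (\<Sum>u\<in>UNIV. ((norm e)\<^sup>2 * (2 * b\<^sup>2 * norm e)) * (1 / fs $ u))"
      proof (rule sum_mono)
        fix u
        have "(e $ u)\<^sup>2 \<le> (norm e)\<^sup>2"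
          using power_mono[OF component_le_norm_cart[of e u] abs_ge_zero, of 2] by simp
        then have "(e $ u)\<^sup>2 * \<bar>A u\<bar> \<le> (norm e)\<^sup>2 * (2 * b\<^sup>2 * norm e)"
          using A_bound[of u] by (intro mult_mono) auto
        moreover have "(e $ u)\<^sup>2 * A u \<le> (e $ u)\<^sup>2 * \<bar>A u\<bar>" by (intro mult_left_mono) auto
        ultimately have "(e $ u)\<^sup>2 * A u \<le> (norm e)\<^sup>2 * (2 * b\<^sup>2 * norm e)" by linarith
        then have "(e $ u)\<^sup>2 * A u * (1 / fs $ u) \<le> (norm e)\<^sup>2 * (2 * b\<^sup>2 * norm e) * (1 / fs $ u)"
          using fs_pos[of u] by (intro mult_right_mono) auto
        then show "(e $ u)\<^sup>2 / fs $ u * A u \<le> (norm e)\<^sup>2 * (2 * b\<^sup>2 * norm e) * (1 / fs $ u)" by simp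
      qed
      also have "\<dots> = ((norm e)\<^sup>2 * (2 * b\<^sup>2 * norm e)) * b"
        unfolding sum_distrib_left[symmetric] by (simp add: b_def fs_inv_sum_def)
      also have "\<dots> = (2 * b ^ 3 * norm e) * (norm e)\<^sup>2" by (simp add: power2_eq_square power3_eq_cube)
      also have "\<dots> \<le> (\<mu> / 4) * (norm e)\<^sup>2"
        using ne(2) b by (intro mult_right_mono) (simp_all add: field_simps)
      finally show ?thesis .
    qed
    have "(\<Sum>u\<in>UNIV. e $ u * drift f $ u / fs $ u) =
        (\<Sum>u\<in>UNIV. e $ u * A u + (e $ u)\<^sup>2 / fs $ u * A u)"
    proof (intro sum.cong refl)
      fix u
      have fu: "f $ u = fs $ u + e $ u" by (simp add: f_eq)
      show "e $ u * drift f $ u / fs $ u = e $ u * A u + (e $ u)\<^sup>2 / fs $ u * A u"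
        unfolding d fu using fs_pos[of u] by (simp add: field_simps power2_eq_square)
    qed
    then have 1: "(\<Sum>u\<in>UNIV. e $ u * drift f $ u / fs $ u) \<le> - (\<mu> / 4) * (norm e)\<^sup>2"
      using first second by (simp add: sum.distrib)
    have "norm (drift f) \<le> (\<Sum>u\<in>UNIV. \<bar>drift f $ u\<bar>)" by (rule norm_le_l1_cart)
    also have "\<dots> \<le> (\<Sum>u\<in>(UNIV::'u set). 2 * b\<^sup>2 * norm e)"
    proof (rule sum_mono)
      fix u
      have "\<bar>drift f $ u\<bar> \<le> 1 * \<bar>A u\<bar>"
        unfolding d abs_mult using prob_simplexD[OF f] by (intro mult_right_mono) auto
      then show "\<bar>drift f $ u\<bar> \<le> 2 * b\<^sup>2 * norm e" using A_bound[of u] by simp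
    qed
    also have "\<dots> = real CARD('u) * (2 * b\<^sup>2) * norm e" by simp
    finally show ?thesis using 1 by (simp add: e_def)
  qed
  show ?thesis
    by (rule that[of \<rho> "\<mu> / 4" "real CARD('u) * (2 * b\<^sup>2)"]) (use \<rho> \<mu>(1) main in auto)
qed

text \<open>In the coordinates \<open>e u / sqrt (fstar u)\<close> the linearized drift is symmetric.\<close>

definition rescale :: "real ^ 'u \<Rightarrow> real ^ 'u" where
  "rescale e = (\<chi> u. e $ u / sqrt (fs $ u))"

lemma norm_le_rescale: "norm e \<le> norm (rescale e)"
proof (rule norm_le_componentwise_cart)
  fix u
  have "sqrt (fs $ u) \<le> 1" using prob_simplexD(3)[OF fs, of u] by simp
  then have "\<bar>e $ u\<bar> * sqrt (fs $ u) \<le> \<bar>e $ u\<bar> * 1" by (intro mult_left_mono) auto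
  then show "norm (e $ u) \<le> norm (rescale e $ u)"
    using fs_pos[of u] by (simp add: rescale_def field_simps)
qed

lemma norm_rescale_le: "norm (rescale e) \<le> fs_inv_sum * norm e"
proof -
  have "norm (rescale e) \<le> norm (fs_inv_sum *\<^sub>R e)"
  proof (rule norm_le_componentwise_cart)
    fix u
    have "sqrt (fs $ u) * sqrt (fs $ u) \<le> sqrt (fs $ u) * 1"
      using prob_simplexD[OF fs] by (intro mult_left_mono) auto
    then have "fs $ u \<le> sqrt (fs $ u)" using fs_pos[of u] by simp
    then have "1 / sqrt (fs $ u) \<le> 1 / fs $ u" using fs_pos[of u] by (intro divide_left_mono) auto
    also have "\<dots> \<le> fs_inv_sum" by (rule fs_inv_le)
    finally have "\<bar>e $ u\<bar> * (1 / sqrt (fs $ u)) \<le> \<bar>e $ u\<bar> * fs_inv_sum" by (intro mult_left_mono) auto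
    then show "norm (rescale e $ u) \<le> norm ((fs_inv_sum *\<^sub>R e) $ u)"
      using fs_pos[of u] fs_inv_sum_ge_1 by (simp add: rescale_def abs_mult mult_ac)
  qed
  then show ?thesis using fs_inv_sum_ge_1 by simp
qed

text \<open>The two norms are comparable with factors 1 and \<open>fs_inv_sum\<close>; the change of
  norm costs the square of that factor in the contraction rate and one factor in the linear
  bound.\<close>

lemma local_drift_rescaled:
  obtains \<rho> c C where "0 < \<rho>" "0 < c"
    "\<And>f. f \<in> prob_simplex \<Longrightarrow> norm (f - fs) < \<rho> \<Longrightarrow>
      inner (rescale (f - fs)) (rescale (drift f)) \<le> - c * (norm (rescale (f - fs)))\<^sup>2"
    "\<And>f. f \<in> prob_simplex \<Longrightarrow> norm (f - fs) < \<rho> \<Longrightarrow>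
      norm (rescale (drift f)) \<le> C * norm (rescale (f - fs))"
proof -
  obtain \<rho> c C where \<rho>: "0 < \<rho>" and c: "0 < c"
    and le: "\<And>f. f \<in> prob_simplex \<Longrightarrow> norm (f - fs) < \<rho> \<Longrightarrow>
      (\<Sum>u\<in>UNIV. (f - fs) $ u * drift f $ u / fs $ u) \<le> - c * (norm (f - fs))\<^sup>2"
    and nd: "\<And>f. f \<in> prob_simplex \<Longrightarrow> norm (f - fs) < \<rho> \<Longrightarrow> norm (drift f) \<le> C * norm (f - fs)"
    by (rule local_drift) blast
  let ?b = fs_inv_sum
  have b: "1 \<le> ?b" by (rule fs_inv_sum_ge_1)
  have inner_eq: "inner (rescale e) (rescale d) = (\<Sum>u\<in>UNIV. e $ u * d $ u / fs $ u)" for e d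
    unfolding inner_vec_def
  proof (intro sum.cong refl)
    fix u
    show "inner (rescale e $ u) (rescale d $ u) = e $ u * d $ u / fs $ u"
      using fs_pos[of u] real_sqrt_mult_self[of "fs $ u"] by (simp add: rescale_def)
  qed
  have 1: "inner (rescale (f - fs)) (rescale (drift f)) \<le> - (c / ?b\<^sup>2) * (norm (rescale (f - fs)))\<^sup>2"
    if "f \<in> prob_simplex" "norm (f - fs) < \<rho>" for f
  proof -
    have "(norm (rescale (f - fs)))\<^sup>2 \<le> (?b * norm (f - fs))\<^sup>2"
      by (intro power_mono norm_rescale_le) auto
    then have "(c / ?b\<^sup>2) * (norm (rescale (f - fs)))\<^sup>2 \<le> (c / ?b\<^sup>2) * (?b * norm (f - fs))\<^sup>2"
      using c by (intro mult_left_mono) auto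
    also have "\<dots> = c * (norm (f - fs))\<^sup>2" using b by (simp add: power_mult_distrib)
    finally show ?thesis using le[OF that] by (simp add: inner_eq)
  qed
  have 2: "norm (rescale (drift f)) \<le> (?b * \<bar>C\<bar>) * norm (rescale (f - fs))"
    if "f \<in> prob_simplex" "norm (f - fs) < \<rho>" for f
  proof -
    have "C * norm (f - fs) \<le> \<bar>C\<bar> * norm (f - fs)" by (intro mult_right_mono) auto
    then have nd': "norm (drift f) \<le> \<bar>C\<bar> * norm (f - fs)" using nd[OF that] by linarith
    have "norm (rescale (drift f)) \<le> ?b * norm (drift f)" by (rule norm_rescale_le)
    also have "\<dots> \<le> ?b * (\<bar>C\<bar> * norm (rescale (f - fs)))"
      using b nd' mult_left_mono[OF norm_le_rescale[of "f - fs"], of "\<bar>C\<bar>"] by (intro mult_left_mono) linarith+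
    finally show ?thesis by (simp add: mult_ac)
  qed
  show ?thesis
  proof (rule that[of \<rho> "c / ?b\<^sup>2" "?b * \<bar>C\<bar>"])
    show "0 < c / ?b\<^sup>2" using c b by simp
  qed (use \<rho> 1 2 in auto)
qed

section \<open>Truncated ratios and their drift\<close>

lemma truncated_ratio_integrable:
  assumes f: "f \<in> prob_simplex" and B: "0 \<le> B"
  shows "integrable Q (\<lambda>y. \<Sum>u\<in>UNIV. fs $ u * min (p u y / mixture p f y) B)"
proof (intro Bochner_Integration.integrable_sum integrable_mult_right)
  fix u
  show "integrable Q (\<lambda>y. min (p u y / mixture p f y) B)"
  proof (rule integrable_const_bound[where B = B])
    show "AE y in Q. norm (min (p u y / mixture p f y) B) \<le> B"
    proof (rule AE_I2)
      fix y assume y: "y \<in> space Q"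
      have "0 \<le> p u y / mixture p f y"
        using y p_nonneg prob_simplexD(1)[OF f] by (intro divide_nonneg_nonneg mixture_nonneg) auto
      then show "norm (min (p u y / mixture p f y) B) \<le> B" using B by auto
    qed
  qed measurable
qed

text \<open>The logarithm of \<open>p (y | u) / m_f y\<close> is integrable uniformly in \<open>f\<close>, although the ratio need
  not be. Truncation at a large level \<open>B\<close> therefore costs little drift away from \<open>fstar\<close>, and none
  near \<open>fstar\<close>, where the ratios are bounded.\<close>

lemma truncated_ratio_drift:
  obtains B \<kappa> where "0 < \<kappa>" "1 \<le> B"
    "\<And>f. f \<in> prob_simplex \<Longrightarrow>
      1 + min (excess f) \<kappa> / 2 \<le> (\<integral>y. (\<Sum>u\<in>UNIV. fs $ u * min (p u y / mixture p f y) B) \<partial>Q)"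
proof -
  define c where "c = Min (range (\<lambda>u. fs $ u))"
  have "c \<in> range (\<lambda>u. fs $ u)" unfolding c_def by (rule Min_in) auto
  then have c: "0 < c" using fs_pos by auto
  have c_le: "c \<le> fs $ u" for u by (simp add: c_def)
  obtain \<kappa> where \<kappa>: "0 < \<kappa>" "\<And>f. f \<in> prob_simplex \<Longrightarrow> c / 2 \<le> norm (f - fs) \<Longrightarrow> \<kappa> \<le> excess f"
    using excess_separated[of "c / 2"] c by auto
  \<comment> \<open>The part of the integrable envelope above a high level n has small integral; n
    is chosen so that it uses up at most half of the gap \<kappa> valid away from
    \<open>fs\<close>.\<close>
  have "(\<lambda>n. \<integral>y. max 0 (envelope y - real n) \<partial>Q) \<longlonglongrightarrow> (\<integral>y. 0 \<partial>Q)"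
  proof (rule integral_dominated_convergence[where w = "\<lambda>y. \<bar>envelope y\<bar>"])
    show "AE y in Q. (\<lambda>n. max 0 (envelope y - real n)) \<longlonglongrightarrow> 0"
    proof (rule AE_I2)
      fix y
      obtain N :: nat where N: "envelope y \<le> real N" using real_arch_simple by blast
      have "\<forall>\<^sub>F n in sequentially. max 0 (envelope y - real n) = 0"
        using N by (intro eventually_sequentiallyI[of N]) simp
      then show "(\<lambda>n. max 0 (envelope y - real n)) \<longlonglongrightarrow> 0" by (rule tendsto_eventually)
    qed
  qed (use integrable_envelope in auto)
  then have "\<forall>\<^sub>F n in sequentially. (\<integral>y. max 0 (envelope y - real n) \<partial>Q) < \<kappa> / 2"
    using \<kappa>(1) by (intro order_tendstoD) auto
  then obtain n where n: "(\<integral>y. max 0 (envelope y - real n) \<partial>Q) < \<kappa> / 2"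
    by (auto simp: eventually_sequentially)
  \<comment> \<open>Level \<open>2 / c\<close> exceeds every ratio as long as all coordinates of f
    are at least c/2, which holds within c/2 of \<open>fs\<close>. Level \<open>exp n / c\<close>
    makes a single truncated term contribute at least \<open>exp n\<close>.\<close>
  define B where "B = max 1 (max (2 / c) (exp (real n) / c))"
  have B: "1 \<le> B" "2 / c \<le> B" "exp (real n) / c \<le> B" by (auto simp: B_def)
  have cB: "exp (real n) \<le> c * B" using B(3) c by (simp add: field_simps)
  have int_max: "integrable Q (\<lambda>y. max 0 (envelope y - real n))"
    using integrable_envelope by (intro integrable_max) auto
  have main: "1 + min (excess f) \<kappa> / 2 \<le> (\<integral>y. (\<Sum>u\<in>UNIV. fs $ u * min (p u y / mixture p f y) B) \<partial>Q)"
    (is "_ \<le> ?I") if f: "f \<in> prob_simplex" for f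
  proof -
    let ?S = "\<lambda>y. \<Sum>u\<in>UNIV. fs $ u * min (p u y / mixture p f y) B"
    let ?R = "\<lambda>y. mixture p fs y / mixture p f y"
    have int_S: "integrable Q ?S" using f B(1) by (intro truncated_ratio_integrable) auto
    have R_eq: "?R y = (\<Sum>u\<in>UNIV. fs $ u * (p u y / mixture p f y))" for y
      by (simp add: mixture_def[of p fs] sum_divide_distrib mult_ac)
    have R_pos: "0 < ?R y" if "\<And>u. 0 < p u y" for y
      using mixture_pos[OF fs, of p y] mixture_pos[OF f, of p y] that by simp
    have no_trunc: "?S y = ?R y" if "\<And>u. p u y / mixture p f y \<le> B" for y
      using that unfolding R_eq by (simp add: min_absorb1)
    have ln_le: "1 + ln (?R y) \<le> ?R y" if "\<And>u. 0 < p u y" for y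
      using ln_le_minus_one[OF R_pos[OF that]] by simp
    show ?thesis
    proof (cases "norm (f - fs) < c / 2")
      case True
      have "c / 2 \<le> f $ u" for u
        using component_le_norm_cart[of "f - fs" u] True c_le[of u] by (simp add: abs_le_iff)
      have "1 + excess f = (\<integral>y. 1 + ln (?R y) \<partial>Q)"
        using integrable_ln_ratio[OF f] by (simp add: excess_def prob_space)
      also have "\<dots> \<le> ?I"
      proof (rule integral_mono_AE)
        show "AE y in Q. 1 + ln (?R y) \<le> ?S y"
          using p_pos
        proof eventually_elim
          case (elim y)
          have "p u y / mixture p f y \<le> B" for u
          proof -
            have "p u y * (c / 2) \<le> p u y * f $ u"
              using elim \<open>c / 2 \<le> f $ u\<close> by (intro mult_left_mono) (auto intro: less_imp_le)
            also have "\<dots> \<le> mixture p f y"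
              using elim prob_simplexD(1)[OF f] by (intro component_le_mixture) (auto intro: less_imp_le)
            finally have "p u y / mixture p f y \<le> 2 / c"
              using c mixture_pos[OF f, of p y] elim by (simp add: field_simps)
            then show ?thesis using B(2) by linarith
          qed
          then show ?case using no_trunc[of y] ln_le[of y] elim by simp
        qed
      qed (use integrable_ln_ratio[OF f] int_S in auto)
      finally show ?thesis using excess_nonneg[OF f] by (simp add: min_def)
    next
      case False
      then have "\<kappa> \<le> excess f" using \<kappa>(2)[OF f] by simp
      then have "1 + \<kappa> / 2 \<le> 1 + excess f - (\<integral>y. max 0 (envelope y - real n) \<partial>Q)" using n by simp
      also have "\<dots> = (\<integral>y. 1 + ln (?R y) - max 0 (envelope y - real n) \<partial>Q)"
        using integrable_ln_ratio[OF f] int_max by (simp add: excess_def prob_space)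
      also have "\<dots> \<le> ?I"
      proof (rule integral_mono_AE)
        show "AE y in Q. 1 + ln (?R y) - max 0 (envelope y - real n) \<le> ?S y"
          using p_pos
        proof eventually_elim
          case (elim y)
          show ?case
          proof (cases "\<forall>u. p u y / mixture p f y \<le> B")
            case True
            then show ?thesis using no_trunc[of y] ln_le[of y] elim by simp
          next
            case False
            then obtain u where u: "B < p u y / mixture p f y" by (auto simp: not_le)
            have nn: "0 \<le> fs $ v * min (p v y / mixture p f y) B" for v
              using elim mixture_pos[OF f, of p y] fs_pos[of v] B(1) by (auto intro!: mult_nonneg_nonneg less_imp_le)
            \<comment> \<open>After subtracting the part of the envelope above n, the left side is
              at most \<open>1 + n\<close>, hence at most \<open>exp n\<close>, which the truncated
              term at u supplies alone.\<close>
            have "exp (real n) \<le> c * B" by (rule cB)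
            also have "\<dots> \<le> fs $ u * min (p u y / mixture p f y) B"
              using u c_le[of u] B(1) by (simp add: min_absorb2)
            also have "\<dots> \<le> ?S y"
              using nn by (intro member_le_sum) auto
            finally have "exp (real n) \<le> ?S y" .
            moreover have "1 + real n \<le> exp (real n)" by (rule exp_ge_add_one_self)
            moreover have "ln (?R y) \<le> envelope y"
              using abs_ln_ratio_le_envelope[OF f, of y] elim by (simp add: abs_le_iff)
            ultimately show ?thesis by linarith
          qed
        qed
      qed (use integrable_ln_ratio[OF f] int_S int_max in auto)
      finally show ?thesis by (simp add: min_def)
    qed
  qed
  show ?thesis by (rule that[of \<kappa> B]) (use \<kappa>(1) B(1) main in auto)
qed

end

section \<open>Consistency\<close>

text \<open>A pathwise form of the Robbins-Siegmund argument. Adding the tail of the series of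
  \<eta>, whose terms may change sign, turns V into a decreasing sequence bounded below; telescoping
  then bounds the partial sums of a.\<close>

lemma almost_decreasing:
  fixes V \<eta> a :: "nat \<Rightarrow> real"
  assumes V: "\<And>n. 0 \<le> V n" and a: "\<And>n. 0 \<le> a n" and \<eta>: "summable \<eta>"
    and rec: "\<And>n. V (Suc n) \<le> V n - a n + \<eta> n"
  shows "convergent V" "summable a"
proof -
  define T where "T n = (\<Sum>k. \<eta> (k + n))" for n
  have T: "T \<longlonglongrightarrow> 0" unfolding T_def by (rule suminf_exist_split2[OF \<eta>])
  have T_Suc: "T n = \<eta> n + T (Suc n)" for n
  proof -
    have "summable (\<lambda>k. \<eta> (k + n))" using \<eta> by (subst summable_iff_shift)
    from suminf_split_head[OF this] show ?thesis by (simp add: T_def)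
  qed
  obtain K where K: "\<And>n. \<bar>T n\<bar> \<le> K"
    using convergent_imp_Bseq[OF convergentI[OF T]] by (auto simp: Bseq_def)
  define U where "U n = V n + T n" for n
  have U_Suc: "U (Suc n) \<le> U n - a n" for n
    using rec[of n] T_Suc[of n] by (simp add: U_def)
  have U_ge: "- K \<le> U n" for n using V[of n] K[of n] by (simp add: U_def abs_le_iff)
  have "decseq U"
  proof (rule decseq_SucI)
    fix n show "U (Suc n) \<le> U n" using U_Suc[of n] a[of n] by linarith
  qed
  from decseq_convergent[OF this, of "- K"] U_ge obtain l where "U \<longlonglongrightarrow> l" by blast
  from tendsto_diff[OF this T] have "V \<longlonglongrightarrow> l - 0" by (simp add: U_def)
  then show "convergent V" by (rule convergentI)
  have sum_le: "(\<Sum>k<n. a k) \<le> U 0 - U n" for n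
  proof (induction n)
    case (Suc n)
    then show ?case using U_Suc[of n] by simp
  qed simp
  have "(\<Sum>k<n. a k) \<le> U 0 + K" for n using sum_le[of n] U_ge[of n] by linarith
  then show "summable a" by (intro summableI_nonneg_bounded a)
qed

lemma weighted_summable_imp_small:
  fixes w G :: "nat \<Rightarrow> real"
  assumes w: "\<And>n. 0 \<le> w n" "\<not> summable w" and wG: "summable (\<lambda>n. w n * G n)" and g: "0 < g"
  shows "\<exists>n\<ge>N. G n < g"
proof (rule ccontr)
  assume "\<not> ?thesis"
  then have ge: "g \<le> G n" if "n \<ge> N" for n using that by (auto simp: not_less)
  have "summable (\<lambda>n. (1 / g) * (w n * G n))" by (rule summable_mult[OF wG])
  then have "summable w"
  proof (rule summable_comparison_test'[of _ N])
    fix n assume "N \<le> n"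
    then have "w n * g \<le> w n * G n" using ge w by (intro mult_left_mono) auto
    then show "norm (w n) \<le> 1 / g * (w n * G n)" using w(1)[of n] g by (simp add: field_simps)
  qed
  with w(2) show False by simp
qed

section \<open>Relative entropy as a Lyapunov function\<close>

definition rel_entropy :: "real ^ 'u::finite \<Rightarrow> real ^ 'u \<Rightarrow> real" where
  "rel_entropy g f = (\<Sum>u\<in>UNIV. g $ u * ln (g $ u / f $ u))"

text \<open>Both vectors have total mass 1, so the squared Hellinger distance is
  \<open>2 - 2 * (\<Sum> u. sqrt (f u * g u))\<close>; the inequality
  \<open>ln s \<le> s - 1\<close> at \<open>s = sqrt (f u / g u)\<close>, averaged with weights
  \<open>g u\<close>, finishes. It yields nonnegativity of the entropy and convergence of
  coordinates at once.\<close>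

lemma hellinger_le_rel_entropy:
  assumes g: "g \<in> prob_simplex" "\<And>u. 0 < g $ u" and f: "f \<in> prob_simplex" "\<And>u. 0 < f $ u"
  shows "(\<Sum>u\<in>UNIV. (sqrt (f $ u) - sqrt (g $ u))\<^sup>2) \<le> rel_entropy g f"
proof -
  have "(\<Sum>u\<in>UNIV. (sqrt (f $ u) - sqrt (g $ u))\<^sup>2) =
      (\<Sum>u\<in>UNIV. f $ u) + (\<Sum>u\<in>UNIV. g $ u) - (\<Sum>u\<in>UNIV. 2 * (sqrt (f $ u) * sqrt (g $ u)))"
    unfolding sum.distrib[symmetric] sum_subtractf[symmetric]
    using less_imp_le[OF g(2)] less_imp_le[OF f(2)]
    by (intro sum.cong refl) (simp add: power2_diff)
  also have "\<dots> = (\<Sum>u\<in>UNIV. 2 * (g $ u) - 2 * (sqrt (f $ u) * sqrt (g $ u)))"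
    using prob_simplexD(2)[OF g(1)] prob_simplexD(2)[OF f(1)]
    by (simp add: sum_subtractf flip: sum_distrib_left)
  also have "\<dots> \<le> rel_entropy g f"
    unfolding rel_entropy_def
  proof (rule sum_mono)
    fix u
    have pos: "0 < f $ u" "0 < g $ u" by (rule f g)+
    define s where "s = sqrt (f $ u) / sqrt (g $ u)"
    have s: "0 < s" using pos by (simp add: s_def)
    have gs: "g $ u * s = sqrt (f $ u) * sqrt (g $ u)"
      using pos real_sqrt_mult_self[of "g $ u"] by (simp add: s_def field_simps)
    have "ln (g $ u / f $ u) = - (2 * ln s)"
      using pos by (simp add: s_def ln_div ln_sqrt)
    moreover have "2 * (1 - s) \<le> - (2 * ln s)" using ln_le_minus_one[OF s] by simp
    ultimately have "2 * (1 - s) \<le> ln (g $ u / f $ u)" by simp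
    then have "g $ u * (2 * (1 - s)) \<le> g $ u * ln (g $ u / f $ u)"
      using pos by (intro mult_left_mono) auto
    then show "2 * g $ u - 2 * (sqrt (f $ u) * sqrt (g $ u)) \<le> g $ u * ln (g $ u / f $ u)"
      by (simp add: gs[symmetric] algebra_simps)
  qed
  finally show ?thesis .
qed

lemma rel_entropy_nonneg:
  assumes "g \<in> prob_simplex" "\<And>u. 0 < g $ u" "f \<in> prob_simplex" "\<And>u. 0 < f $ u"
  shows "0 \<le> rel_entropy g f"
  using hellinger_le_rel_entropy[OF assms] sum_nonneg[of UNIV "\<lambda>u. (sqrt (f $ u) - sqrt (g $ u))\<^sup>2"]
  by simp

lemma rel_entropy_tendsto_0_imp_tendsto:
  fixes f :: "nat \<Rightarrow> real ^ 'u::finite"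
  assumes g: "g \<in> prob_simplex" "\<And>u. 0 < g $ u"
    and f: "\<And>n. f n \<in> prob_simplex" "\<And>n u. 0 < f n $ u"
    and lim: "(\<lambda>n. rel_entropy g (f n)) \<longlonglongrightarrow> 0"
  shows "f \<longlonglongrightarrow> g"
proof (rule vec_tendstoI)
  fix u
  have "(\<lambda>n. (sqrt (f n $ u) - sqrt (g $ u))\<^sup>2) \<longlonglongrightarrow> 0"
  proof (rule tendsto_sandwich[OF _ _ tendsto_const lim])
    show "\<forall>\<^sub>F n in sequentially. (sqrt (f n $ u) - sqrt (g $ u))\<^sup>2 \<le> rel_entropy g (f n)"
    proof (rule always_eventually, rule allI)
      fix n
      have "(sqrt (f n $ u) - sqrt (g $ u))\<^sup>2 \<le> (\<Sum>u\<in>UNIV. (sqrt (f n $ u) - sqrt (g $ u))\<^sup>2)"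
        by (rule member_le_sum[of u UNIV "\<lambda>u. (sqrt (f n $ u) - sqrt (g $ u))\<^sup>2"]) auto
      also have "\<dots> \<le> rel_entropy g (f n)" by (rule hellinger_le_rel_entropy[OF g f])
      finally show "(sqrt (f n $ u) - sqrt (g $ u))\<^sup>2 \<le> rel_entropy g (f n)" .
    qed
  qed simp
  from tendsto_real_sqrt[OF this] have "(\<lambda>n. sqrt (f n $ u) - sqrt (g $ u)) \<longlonglongrightarrow> 0"
    by (simp add: tendsto_rabs_zero_iff)
  from tendsto_add[OF this tendsto_const[of "sqrt (g $ u)"]]
  have "(\<lambda>n. (sqrt (f n $ u))\<^sup>2) \<longlonglongrightarrow> (sqrt (g $ u))\<^sup>2" by (intro tendsto_power) simp
  then show "(\<lambda>n. f n $ u) \<longlonglongrightarrow> g $ u"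
    using less_imp_le[OF f(2)] less_imp_le[OF g(2)] by simp
qed

definition pr_step :: "('u::finite \<Rightarrow> 'y \<Rightarrow> real) \<Rightarrow> real \<Rightarrow> real ^ 'u \<Rightarrow> 'y \<Rightarrow> real ^ 'u" where
  "pr_step p w f y = (\<chi> u. (1 - w) * f $ u + w * (p u y * f $ u / mixture p f y))"

lemma pr_step_in_simplex:
  assumes f: "f \<in> prob_simplex" "\<And>u. 0 < f $ u" and p: "\<And>u. 0 < p u y" and w: "0 < w" "w < 1"
  shows "pr_step p w f y \<in> prob_simplex" "0 < pr_step p w f y $ u"
proof -
  have m: "0 < mixture p f y" using mixture_pos[OF f(1), of p y] p by simp
  show pos: "0 < pr_step p w f y $ u" for u
    unfolding pr_step_def using f(2)[of u] p[of u] m w by (simp add: add_pos_pos)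
  have "(\<Sum>u\<in>UNIV. pr_step p w f y $ u) =
      (1 - w) * (\<Sum>u\<in>UNIV. f $ u) + w * ((\<Sum>u\<in>UNIV. p u y * f $ u) / mixture p f y)"
    by (simp add: pr_step_def sum.distrib sum_distrib_left sum_divide_distrib)
  also have "\<dots> = 1" using m prob_simplexD(2)[OF f(1)] by (simp add: mixture_def)
  finally show "pr_step p w f y \<in> prob_simplex"
    using less_imp_le[OF pos] by (simp add: prob_simplex_def)
qed

text \<open>Applying \<open>ln x \<le> x - 1\<close> at \<open>1 / (1 + t)\<close> gives
  \<open>ln (1 + t) \<ge> t - t\<^sup>2 / (1 + t)\<close>. The form with b tolerates weights near 1,
  as long as they are bounded away from it.\<close>

lemma ln_ge_sub_square:
  fixes t b :: real
  assumes "- b \<le> t" "b < 1"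
  shows "t - t\<^sup>2 / (1 - b) \<le> ln (1 + t)"
proof -
  have pos: "0 < 1 - b" "1 - b \<le> 1 + t" using assms by auto
  have "ln (1 / (1 + t)) \<le> 1 / (1 + t) - 1" using pos by (intro ln_le_minus_one) auto
  then have "1 - 1 / (1 + t) \<le> ln (1 + t)" using pos by (simp add: ln_div)
  moreover have "1 - 1 / (1 + t) = t - t\<^sup>2 / (1 + t)"
    using pos by (simp add: field_simps power2_eq_square)
  moreover have "t\<^sup>2 / (1 + t) \<le> t\<^sup>2 / (1 - b)" using pos by (intro divide_left_mono) auto
  ultimately show ?thesis by linarith
qed

context interior_KL_minimizer
begin

text \<open>A lower bound for the entropy decrease in one step. Without the cap B it would be the
  exact decrease; the cap makes it bounded and of order w, as the martingale argument
  requires.\<close>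

definition log_gain :: "real \<Rightarrow> real \<Rightarrow> real ^ 'u \<Rightarrow> 'y \<Rightarrow> real" where
  "log_gain B w f y = (\<Sum>u\<in>UNIV. fs $ u * ln (1 + w * (min (p u y / mixture p f y) B - 1)))"

lemma rel_entropy_pr_step:
  assumes f: "f \<in> prob_simplex" "\<And>u. 0 < f $ u" and p: "\<And>u. 0 < p u y"
    and w: "0 < w" "w < 1" and B: "0 \<le> B"
  shows "rel_entropy fs (pr_step p w f y) \<le> rel_entropy fs f - log_gain B w f y"
  unfolding rel_entropy_def log_gain_def sum_subtractf[symmetric]
proof (rule sum_mono)
  fix u
  have m: "0 < mixture p f y" using mixture_pos[OF f(1), of p y] p by simp
  define r where "r = p u y / mixture p f y"
  have r: "0 < r" using m p[of u] by (simp add: r_def)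
  have step: "pr_step p w f y $ u = f $ u * (1 + w * (r - 1))"
    by (simp add: pr_step_def r_def algebra_simps)
  have "0 \<le> w * min r B" using r B w by simp
  then have pos: "0 < 1 + w * (min r B - 1)" using w by (simp add: algebra_simps)
  have le: "1 + w * (min r B - 1) \<le> 1 + w * (r - 1)" using w by simp
  have "ln (fs $ u / pr_step p w f y $ u) = ln (fs $ u / f $ u) - ln (1 + w * (r - 1))"
    using fs_pos[of u] f(2)[of u] pos le unfolding step by (simp add: ln_div ln_mult)
  also have "\<dots> \<le> ln (fs $ u / f $ u) - ln (1 + w * (min r B - 1))"
    using pos le by simp
  finally have "fs $ u * ln (fs $ u / pr_step p w f y $ u) \<le>
      fs $ u * (ln (fs $ u / f $ u) - ln (1 + w * (min r B - 1)))"
    using fs_pos[of u] by (intro mult_left_mono) auto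
  then show "fs $ u * ln (fs $ u / pr_step p w f y $ u) \<le> fs $ u * ln (fs $ u / f $ u) -
      fs $ u * ln (1 + w * (min (p u y / mixture p f y) B - 1))"
    by (simp add: r_def right_diff_distrib)
qed

text \<open>The truncated ratio minus 1 lies between -1 and B, so the argument of the logarithm is
  at least \<open>1 - b\<close>. The first bound makes the centred gains square summable; the second
  is the expansion to second order in w, whose linear term carries the drift.\<close>

lemma log_gain_bounds:
  assumes r: "\<And>u. 0 \<le> p u y / mixture p f y" and w: "0 \<le> w" "w \<le> b" "b < 1" and B: "1 \<le> B"
  shows "\<bar>log_gain B w f y\<bar> \<le> w * (B / (1 - b))"
    and "w * ((\<Sum>u\<in>UNIV. fs $ u * min (p u y / mixture p f y) B) - 1) - w\<^sup>2 * (B\<^sup>2 / (1 - b))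
      \<le> log_gain B w f y"
proof -
  define x where "x u = min (p u y / mixture p f y) B - 1" for u
  have x: "- 1 \<le> x u" "x u \<le> B" "\<bar>x u\<bar> \<le> B" for u using r[of u] B by (auto simp: x_def)
  have wx: "- b \<le> w * x u" for u
  proof -
    have "w * (- 1) \<le> w * x u" using w x by (intro mult_left_mono) auto
    then show ?thesis using w by simp
  qed
  have sum_fs: "(\<Sum>u\<in>UNIV. fs $ u) = 1" by (rule prob_simplexD(2)[OF fs])
  have B': "B \<le> B / (1 - b)" using w B by (simp add: field_simps)
  have ln_bound: "\<bar>ln (1 + w * x u)\<bar> \<le> w * (B / (1 - b))" for u
  proof -
    have pos: "0 < 1 - b" "1 - b \<le> 1 + w * x u" using wx[of u] w by auto
    have "w * x u \<le> w * B" using x w by (intro mult_left_mono) auto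
    moreover have "w * B \<le> w * (B / (1 - b))" using B' w by (intro mult_left_mono) auto
    moreover have "ln (1 + w * x u) \<le> w * x u" using pos w by (intro ln_add_one_self_le_self2) auto
    ultimately have up: "ln (1 + w * x u) \<le> w * (B / (1 - b))" by linarith
    have "ln (1 / (1 + w * x u)) \<le> 1 / (1 + w * x u) - 1" using pos by (intro ln_le_minus_one) auto
    then have "- ln (1 + w * x u) \<le> (- (w * x u)) / (1 + w * x u)"
      using pos by (simp add: ln_div field_simps)
    also have "\<dots> \<le> (w * B) / (1 + w * x u)"
      using pos w x(3)[of u] mult_left_mono[of "- x u" B w] by (intro divide_right_mono) (auto simp: abs_le_iff)
    also have "\<dots> \<le> (w * B) / (1 - b)" using pos w B by (intro divide_left_mono) auto
    finally show ?thesis using up by simp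
  qed
  have "\<bar>log_gain B w f y\<bar> \<le> (\<Sum>u\<in>UNIV. \<bar>fs $ u * ln (1 + w * x u)\<bar>)"
    unfolding log_gain_def x_def by (rule sum_abs)
  also have "\<dots> \<le> (\<Sum>u\<in>UNIV. fs $ u * (w * (B / (1 - b))))"
    unfolding abs_mult using fs_pos ln_bound by (intro sum_mono mult_mono) (auto intro: less_imp_le)
  also have "\<dots> = w * (B / (1 - b))" unfolding sum_distrib_right[symmetric] sum_fs by simp
  finally show "\<bar>log_gain B w f y\<bar> \<le> w * (B / (1 - b))" .
  have "w * ((\<Sum>u\<in>UNIV. fs $ u * min (p u y / mixture p f y) B) - 1) - w\<^sup>2 * (B\<^sup>2 / (1 - b)) =
      (\<Sum>u\<in>UNIV. fs $ u * (w * x u - w\<^sup>2 * (B\<^sup>2 / (1 - b))))"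
  proof -
    have "(\<Sum>u\<in>UNIV. fs $ u * (w * x u - w\<^sup>2 * (B\<^sup>2 / (1 - b)))) =
        w * (\<Sum>u\<in>UNIV. fs $ u * x u) - (\<Sum>u\<in>UNIV. fs $ u) * (w\<^sup>2 * (B\<^sup>2 / (1 - b)))"
      unfolding right_diff_distrib sum_subtractf sum_distrib_left sum_distrib_right
      by (simp add: mult.left_commute)
    also have "(\<Sum>u\<in>UNIV. fs $ u * x u) = (\<Sum>u\<in>UNIV. fs $ u * min (p u y / mixture p f y) B) - 1"
      using sum_fs by (simp add: x_def right_diff_distrib sum_subtractf)
    finally show ?thesis by (simp add: sum_fs)
  qed
  also have "\<dots> \<le> (\<Sum>u\<in>UNIV. fs $ u * ln (1 + w * x u))"
  proof (intro sum_mono mult_left_mono)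
    fix u
    have "(x u)\<^sup>2 \<le> B\<^sup>2" using power_mono[OF x(3)[of u] abs_ge_zero, of 2] by simp
    then have "(w * x u)\<^sup>2 / (1 - b) \<le> w\<^sup>2 * B\<^sup>2 / (1 - b)"
      using w by (intro divide_right_mono) (auto simp: power_mult_distrib intro!: mult_left_mono)
    then show "w * x u - w\<^sup>2 * (B\<^sup>2 / (1 - b)) \<le> ln (1 + w * x u)"
      using ln_ge_sub_square[OF wx[of u] w(3)] by simp
  qed (use fs_pos in \<open>auto intro: less_imp_le\<close>)
  finally show "w * ((\<Sum>u\<in>UNIV. fs $ u * min (p u y / mixture p f y) B) - 1) - w\<^sup>2 * (B\<^sup>2 / (1 - b))
      \<le> log_gain B w f y"
    by (simp add: log_gain_def x_def)
qed

lemma ratio_nonneg: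
  assumes "\<And>u. 0 \<le> f $ u" "y \<in> space Q"
  shows "0 \<le> p u y / mixture p f y"
  using assms p_nonneg by (intro divide_nonneg_nonneg mixture_nonneg) auto

lemma log_gain_measurable [measurable]: "log_gain B w f \<in> borel_measurable Q"
  unfolding log_gain_def[abs_def] by measurable

lemma integral_log_gain_ge:
  assumes f: "f \<in> prob_simplex" and w: "0 \<le> w" "w \<le> b" "b < 1" and B: "1 \<le> B"
    and drift: "1 + g \<le> (\<integral>y. (\<Sum>u\<in>UNIV. fs $ u * min (p u y / mixture p f y) B) \<partial>Q)"
  shows "w * g - w\<^sup>2 * (B\<^sup>2 / (1 - b)) \<le> (\<integral>y. log_gain B w f y \<partial>Q)"
proof -
  let ?S = "\<lambda>y. \<Sum>u\<in>UNIV. fs $ u * min (p u y / mixture p f y) B"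
  have int: "integrable Q ?S" using f B by (intro truncated_ratio_integrable) auto
  have r: "0 \<le> p u y / mixture p f y" if "y \<in> space Q" for u y
    by (rule ratio_nonneg) (use prob_simplexD(1)[OF f] that in auto)
  have "w * g \<le> w * ((\<integral>y. ?S y \<partial>Q) - 1)" using drift w by (intro mult_left_mono) auto
  then have "w * g - w\<^sup>2 * (B\<^sup>2 / (1 - b)) \<le> (\<integral>y. w * (?S y - 1) - w\<^sup>2 * (B\<^sup>2 / (1 - b)) \<partial>Q)"
    using int by (simp add: prob_space)
  also have "\<dots> \<le> (\<integral>y. log_gain B w f y \<partial>Q)"
  proof (rule integral_mono)
    show "integrable Q (log_gain B w f)"
      by (rule integrable_const_bound[where B = "w * (B / (1 - b))"])
        (use log_gain_bounds(1)[OF r w B] in \<open>auto intro!: AE_I2\<close>)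
  qed (use int log_gain_bounds(2)[OF r w B] in auto)
  finally show ?thesis .
qed

text \<open>The entropy converges and the weighted excess is summable. A positive limit v would keep
  the iterates outside a ball around \<open>fs\<close>, because the entropy is continuous and 0
  there; the excess would then stay above a fixed gap, whereas divergence of the weights forces
  arbitrarily late small values.\<close>

lemma tendsto_minimizer:
  fixes f :: "nat \<Rightarrow> real ^ 'u" and w \<eta> :: "nat \<Rightarrow> real"
  assumes f: "\<And>n. f n \<in> prob_simplex" "\<And>n u. 0 < f n $ u"
    and w: "\<And>n. 0 \<le> w n" "\<not> summable w" and \<kappa>: "0 < \<kappa>" and \<eta>: "summable \<eta>"
    and rec: "\<And>n. rel_entropy fs (f (Suc n)) \<le>
      rel_entropy fs (f n) - w n * (min (excess (f n)) \<kappa> / 2) + \<eta> n"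
  shows "f \<longlonglongrightarrow> fs"
proof -
  define V where "V n = rel_entropy fs (f n)" for n
  define G where "G n = min (excess (f n)) \<kappa> / 2" for n
  have V0: "0 \<le> V n" for n unfolding V_def by (rule rel_entropy_nonneg[OF fs fs_pos f])
  have wG0: "0 \<le> w n * G n" for n using w(1) excess_nonneg[OF f(1)] \<kappa> by (simp add: G_def)
  have rec': "V (Suc n) \<le> V n - w n * G n + \<eta> n" for n using rec[of n] by (simp add: V_def G_def)
  obtain v where v: "V \<longlonglongrightarrow> v"
    using almost_decreasing(1)[OF V0 wG0 \<eta> rec'] by (auto simp: convergent_def)
  have sum_wG: "summable (\<lambda>n. w n * G n)" by (rule almost_decreasing(2)[OF V0 wG0 \<eta> rec'])
  have "0 \<le> v" by (rule LIMSEQ_le_const[OF v]) (use V0 in auto)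
  have "v = 0"
  proof (rule ccontr)
    assume "v \<noteq> 0"
    with \<open>0 \<le> v\<close> have v0: "0 < v / 2" "v / 2 < v" by auto
    have "isCont (rel_entropy fs) fs"
      unfolding rel_entropy_def[abs_def]
      by (intro continuous_intros) (use fs_pos in \<open>auto simp: less_imp_neq[symmetric] intro: less_imp_neq\<close>)
    moreover have "rel_entropy fs fs = 0"
      using less_imp_neq[OF fs_pos, symmetric] by (simp add: rel_entropy_def)
    ultimately have "(rel_entropy fs \<longlongrightarrow> 0) (at fs)" by (simp add: isCont_def)
    from order_tendstoD(2)[OF this v0(1)] obtain \<rho> where \<rho>: "0 < \<rho>"
      "\<And>g. g \<noteq> fs \<Longrightarrow> dist g fs < \<rho> \<Longrightarrow> rel_entropy fs g < v / 2"
      by (auto simp: eventually_at)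
    have small: "rel_entropy fs g < v / 2" if "norm (g - fs) < \<rho>" for g
      using \<rho>(2)[of g] that \<open>rel_entropy fs fs = 0\<close> v0 by (cases "g = fs") (auto simp: dist_norm)
    obtain \<kappa>' where \<kappa>': "0 < \<kappa>'" "\<And>g. g \<in> prob_simplex \<Longrightarrow> \<rho> \<le> norm (g - fs) \<Longrightarrow> \<kappa>' \<le> excess g"
      using excess_separated[OF \<rho>(1)] by blast
    obtain N where N: "\<And>n. n \<ge> N \<Longrightarrow> v / 2 < V n"
      using order_tendstoD(1)[OF v v0(2)] by (auto simp: eventually_sequentially)
    obtain n where n: "n \<ge> N" "G n < min \<kappa>' \<kappa> / 2"
      using weighted_summable_imp_small[OF w sum_wG, of "min \<kappa>' \<kappa> / 2" N] \<kappa> \<kappa>'(1) by auto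
    have "\<rho> \<le> norm (f n - fs)" using small[of "f n"] N[OF n(1)] by (force simp: V_def)
    then have "\<kappa>' \<le> excess (f n)" by (rule \<kappa>'(2)[OF f(1)])
    then show False using n(2) by (simp add: G_def min_def split: if_splits)
  qed
  with v have "(\<lambda>n. rel_entropy fs (f n)) \<longlonglongrightarrow> 0" by (simp add: V_def[abs_def])
  then show ?thesis by (rule rel_entropy_tendsto_0_imp_tendsto[OF fs fs_pos f])
qed

end

section \<open>Convergence rate of predictive recursion\<close>

lemma pred_rec_Suc: "pred_rec p w f0 y (Suc n) = pr_step p (w (Suc n)) (pred_rec p w f0 y n) (y (Suc n))"
  by (simp add: pr_step_def Let_def)

lemma pred_rec_cong:
  assumes "\<And>i. 1 \<le> i \<Longrightarrow> i \<le> n \<Longrightarrow> y i = z i"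
  shows "pred_rec p w f0 y n = pred_rec p w f0 z n"
  using assms by (induction n) (simp_all add: pred_rec_Suc del: pred_rec.simps(2))

text \<open>The martingale bounds are pointwise on the whole history space, where kernel values may
  be 0; nonnegativity survives there, while strict positivity is available only almost
  surely.\<close>

lemma pred_rec_nonneg:
  assumes p: "\<And>i u. 1 \<le> i \<Longrightarrow> i \<le> n \<Longrightarrow> 0 \<le> p u (y i)"
    and w: "\<And>i. 1 \<le> i \<Longrightarrow> 0 \<le> w i \<and> w i \<le> 1" and f0: "\<And>u. 0 \<le> f0 $ u"
  shows "0 \<le> pred_rec p w f0 y n $ u"
  using p
proof (induction n arbitrary: u)
  case 0
  then show ?case using f0 by simp
next
  case (Suc n)
  have IH: "0 \<le> pred_rec p w f0 y n $ u" for u by (rule Suc.IH) (use Suc.prems in auto)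
  have py: "0 \<le> p u (y (Suc n))" for u using Suc.prems[of "Suc n"] by simp
  have m: "0 \<le> mixture p (pred_rec p w f0 y n) (y (Suc n))" by (rule mixture_nonneg) (use py IH in auto)
  show ?case
    using w[of "Suc n"] IH[of u] py[of u] m
    by (auto simp: pred_rec_Suc pr_step_def simp del: pred_rec.simps(2) intro!: add_nonneg_nonneg)
qed

lemma pred_rec_in_simplex:
  assumes p: "\<And>i u. 1 \<le> i \<Longrightarrow> 0 < p u (y i)" and w: "\<And>i. 1 \<le> i \<Longrightarrow> 0 < w i \<and> w i < 1"
    and f0: "f0 \<in> prob_simplex" "\<And>u. 0 < f0 $ u"
  shows "pred_rec p w f0 y n \<in> prob_simplex \<and> (\<forall>u. 0 < pred_rec p w f0 y n $ u)"
proof (induction n)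
  case 0
  then show ?case using f0 by simp
next
  case (Suc n)
  then show ?case
    unfolding pred_rec_Suc using p[of "Suc n"] w[of "Suc n"]
    by (intro conjI allI pr_step_in_simplex) auto
qed

lemma borel_measurable_vecI:
  fixes f :: "'a \<Rightarrow> real ^ 'n::finite"
  assumes "\<And>i. (\<lambda>x. f x $ i) \<in> borel_measurable M"
  shows "f \<in> borel_measurable M"
  unfolding borel_measurable_euclidean_space[of f]
  using assms by (auto simp: Basis_vec_def inner_axis)

lemma pred_rec_measurable:
  assumes p: "\<And>u. p u \<in> borel_measurable N" and n: "n \<le> k"
  shows "(\<lambda>h. pred_rec p w f0 h n) \<in> borel_measurable (PiM {1..k} (\<lambda>_. N))"
  using n
proof (induction n)
  case 0
  then show ?case by simp
next
  case (Suc n)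
  then have IH [measurable]: "(\<lambda>h. pred_rec p w f0 h n) \<in> borel_measurable (PiM {1..k} (\<lambda>_. N))" by simp
  have [measurable]: "(\<lambda>h. p u (h (Suc n))) \<in> borel_measurable (PiM {1..k} (\<lambda>_. N))" for u
    by (rule measurable_compose[where g = "p u", OF measurable_component_singleton]) (use Suc.prems p in auto)
  have [measurable]: "(\<lambda>h. pred_rec p w f0 h n $ u) \<in> borel_measurable (PiM {1..k} (\<lambda>_. N))" for u
    by (rule measurable_compose[OF IH borel_measurable_nth])
  show ?case
    unfolding pred_rec_Suc pr_step_def by (rule borel_measurable_vecI) (simp only: vec_lambda_beta, measurable)
qed

context interior_KL_minimizer
begin

text \<open>Two kinds of martingale series are controlled. The truncated gains give consistency; the
  posterior weights of each u, scaled by \<open>w powr (1 - \<delta>)\<close>, give the noise in the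
  rate argument. Outside a null set all else is deterministic.\<close>

theorem pred_rec_rate:
  fixes P :: "'w measure" and N :: "'y measure" and Y :: "nat \<Rightarrow> 'w \<Rightarrow> 'y" and w :: "nat \<Rightarrow> real"
  assumes "prob_space P" and sets_Q: "sets Q = sets N"
    and indep: "prob_space.indep_vars P (\<lambda>_. N) Y {1..}"
    and distr: "\<And>i. i \<ge> 1 \<Longrightarrow> distr P N (Y i) = Q"
    and weights: "\<And>n. n \<ge> 1 \<Longrightarrow> 0 < w n \<and> w n < 1"
    and f0: "f0 \<in> prob_simplex" "\<And>u. 0 < f0 $ u"
    and eps: "0 < \<epsilon>" and w_div: "\<not> summable (\<lambda>n. w (Suc n))"
    and w_sum: "summable (\<lambda>n. w (Suc n) powr (1 + \<epsilon>))"
    and w_inv: "(\<lambda>n. inverse (w (Suc n)) - inverse (w n)) \<longlonglongrightarrow> 0"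
    and \<delta>: "0 < \<delta>" "\<delta> \<le> (1 - \<epsilon>) / 2"
  shows "AE \<omega> in P. (\<lambda>n. norm (pred_rec p w f0 (\<lambda>i. Y i \<omega>) n - fs)) \<in> o(\<lambda>n. w n powr \<delta>)"
proof -
  interpret P: prob_space P by fact
  have space_Q: "space Q = space N" by (rule sets_eq_imp_space_eq[OF sets_Q])
  have pN [measurable]: "p u \<in> borel_measurable N" for u
    using p_meas[of u] measurable_cong_sets[OF sets_Q refl, of borel] by blast
  have Y [measurable]: "Y i \<in> P \<rightarrow>\<^sub>M N" if "i \<ge> 1" for i
    using indep that by (auto simp: P.indep_vars_def)
  have ws: "0 < w (Suc n)" "w (Suc n) < 1" for n using weights[of "Suc n"] by auto
  have \<delta>1: "\<delta> < 1 / 2" "1 + \<epsilon> \<le> 2 * (1 - \<delta>)" using \<delta> eps by auto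
  \<comment> \<open>That some positive \<delta> is admissible excludes \<epsilon> = 1; in particular
    the squared weights are summable.\<close>
  have "0 < (1 - \<epsilon>) / 2" using \<delta> by (rule less_le_trans)
  then have "\<epsilon> < 1" by simp
  have powr_sum: "summable (\<lambda>n. w (Suc n) powr s)" if "1 + \<epsilon> \<le> s" for s
  proof (rule summable_comparison_test'[OF w_sum, of 0])
    fix n show "norm (w (Suc n) powr s) \<le> w (Suc n) powr (1 + \<epsilon>)"
      using powr_mono'[OF that, of "w (Suc n)"] ws[of n] by simp
  qed
  have sq_sum: "summable (\<lambda>n. (w (Suc n))\<^sup>2)"
    using powr_sum[of 2] \<open>\<epsilon> < 1\<close> less_imp_le[OF ws(1)] by (simp add: powr_numeral)
  have w0_Suc: "(\<lambda>n. w (Suc n)) \<longlonglongrightarrow> 0"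
    using tendsto_real_sqrt[OF summable_LIMSEQ_zero[OF sq_sum]] less_imp_le[OF ws(1)] by simp
  then have w0: "w \<longlonglongrightarrow> 0" by (rule LIMSEQ_imp_Suc)
  \<comment> \<open>The weights tend to 0, so a bound of 1/2 fails for finitely many of them, and
    each of those is below 1.\<close>
  obtain b where b: "b < 1" "\<And>n. w (Suc n) \<le> b"
  proof -
    obtain n0 where n0: "\<And>n. n \<ge> n0 \<Longrightarrow> w (Suc n) < 1 / 2"
      using order_tendstoD(2)[OF w0_Suc, of "1 / 2"] by (auto simp: eventually_sequentially)
    define b where "b = Max (insert (1 / 2) ((\<lambda>n. w (Suc n)) ` {..<n0}))"
    have "b < 1" unfolding b_def using ws by simp
    moreover have "w (Suc n) \<le> b" for n
    proof (cases "n < n0")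
      case True
      then show ?thesis unfolding b_def by (intro Max_ge) auto
    next
      case False
      then have "w (Suc n) \<le> 1 / 2" using n0[of n] by simp
      also have "1 / 2 \<le> b" unfolding b_def by (intro Max_ge) auto
      finally show ?thesis .
    qed
    ultimately show ?thesis by (rule that)
  qed
  obtain B \<kappa> where \<kappa>: "0 < \<kappa>" and B: "1 \<le> B" and trunc: "\<And>f. f \<in> prob_simplex \<Longrightarrow>
      1 + min (excess f) \<kappa> / 2 \<le> (\<integral>y. (\<Sum>u\<in>UNIV. fs $ u * min (p u y / mixture p f y) B) \<partial>Q)"
    by (rule truncated_ratio_drift) blast
  let ?H = "\<lambda>n. PiM {1..n} (\<lambda>_::nat. N)"
  let ?S = "\<lambda>n h. pred_rec p w f0 h n"
  have S [measurable]: "?S n \<in> borel_measurable (?H n)" for n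
    by (rule pred_rec_measurable[OF pN]) simp
  have S_nonneg: "0 \<le> ?S n h $ u" if "h \<in> space (?H n)" for n h u
  proof (rule pred_rec_nonneg)
    fix i v assume "1 \<le> i" "i \<le> n"
    then have "h i \<in> space Q" using that by (auto simp: space_PiM space_Q)
    then show "0 \<le> p v (h i)" by (rule p_nonneg)
  qed (use weights f0(2) in \<open>auto intro: less_imp_le\<close>)
  \<comment> \<open>The recursion reads only observations 1 to n, so the truncated history used for
    measurability gives the same state as the full path.\<close>
  have S_restrict: "?S n (\<lambda>i\<in>{1..n}. Y i \<omega>) = ?S n (\<lambda>i. Y i \<omega>)" for n \<omega>
    by (rule pred_rec_cong) auto
  have S_pair: "(\<lambda>z. ?S n (fst z)) \<in> borel_measurable (?H n \<Otimes>\<^sub>M N)" for n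
    by (rule measurable_compose[OF measurable_fst S])
  have p_pair: "(\<lambda>z. p u (snd z)) \<in> borel_measurable (?H n \<Otimes>\<^sub>M N)" for n :: nat and u
    by (rule measurable_compose[OF measurable_snd pN])
  have mix_pair: "(\<lambda>z. mixture p (?S n (fst z)) (snd z)) \<in> borel_measurable (?H n \<Otimes>\<^sub>M N)" for n
    by (intro borel_measurable_mixture p_pair S_pair)
  note [measurable] = p_pair mix_pair measurable_compose[OF S_pair borel_measurable_nth]

  have gain: "AE \<omega> in P. summable (\<lambda>n. log_gain B (w (Suc n)) (?S n (\<lambda>i. Y i \<omega>)) (Y (Suc n) \<omega>)
      - (\<integral>y. log_gain B (w (Suc n)) (?S n (\<lambda>i. Y i \<omega>)) y \<partial>Q))"
  proof -
    have "AE \<omega> in P. summable (\<lambda>n. log_gain B (w (Suc n)) (?S n (\<lambda>i\<in>{1..n}. Y i \<omega>)) (Y (Suc n) \<omega>)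
      - (\<integral>y. log_gain B (w (Suc n)) (?S n (\<lambda>i\<in>{1..n}. Y i \<omega>)) y \<partial>Q))"
    proof (rule P.innovations_summable_AE[OF indep distr, where c = "\<lambda>n. w (Suc n) * (B / (1 - b))"])
      show "(\<lambda>(h, y). log_gain B (w (Suc n)) (?S n h) y) \<in> borel_measurable (?H n \<Otimes>\<^sub>M N)" for n
        unfolding log_gain_def case_prod_beta by measurable
      show "\<bar>log_gain B (w (Suc n)) (?S n h) y\<bar> \<le> w (Suc n) * (B / (1 - b))"
        if "h \<in> space (?H n)" "y \<in> space N" for n h y
        by (rule log_gain_bounds(1)[OF ratio_nonneg _ b(2) b(1) B])
          (use S_nonneg[OF that(1)] that(2) less_imp_le[OF ws(1)] in \<open>auto simp: space_Q\<close>)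
      show "summable (\<lambda>n. (w (Suc n) * (B / (1 - b)))\<^sup>2)"
        unfolding power_mult_distrib by (rule summable_mult2[OF sq_sum])
    qed
    then show ?thesis by (simp only: S_restrict)
  qed
  have noise: "AE \<omega> in P. summable (\<lambda>n. w (Suc n) powr (1 - \<delta>) *
        (p u (Y (Suc n) \<omega>) * ?S n (\<lambda>i. Y i \<omega>) $ u / mixture p (?S n (\<lambda>i. Y i \<omega>)) (Y (Suc n) \<omega>))
      - (\<integral>y. w (Suc n) powr (1 - \<delta>) *
        (p u y * ?S n (\<lambda>i. Y i \<omega>) $ u / mixture p (?S n (\<lambda>i. Y i \<omega>)) y) \<partial>Q))" for u
  proof -
    have "AE \<omega> in P. summable (\<lambda>n. w (Suc n) powr (1 - \<delta>) *
        (p u (Y (Suc n) \<omega>) * ?S n (\<lambda>i\<in>{1..n}. Y i \<omega>) $ u /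
          mixture p (?S n (\<lambda>i\<in>{1..n}. Y i \<omega>)) (Y (Suc n) \<omega>))
      - (\<integral>y. w (Suc n) powr (1 - \<delta>) *
        (p u y * ?S n (\<lambda>i\<in>{1..n}. Y i \<omega>) $ u / mixture p (?S n (\<lambda>i\<in>{1..n}. Y i \<omega>)) y) \<partial>Q))"
    proof (rule P.innovations_summable_AE[OF indep distr, where c = "\<lambda>n. w (Suc n) powr (1 - \<delta>)"])
      show "(\<lambda>(h, y). w (Suc n) powr (1 - \<delta>) * (p u y * ?S n h $ u / mixture p (?S n h) y))
          \<in> borel_measurable (?H n \<Otimes>\<^sub>M N)" for n
        unfolding case_prod_beta by measurable
      show "\<bar>w (Suc n) powr (1 - \<delta>) * (p u y * ?S n h $ u / mixture p (?S n h) y)\<bar> \<le> w (Suc n) powr (1 - \<delta>)"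
        if "h \<in> space (?H n)" "y \<in> space N" for n h y
      proof -
        have py: "0 \<le> p v y" for v using p_nonneg that(2) by (simp add: space_Q)
        have f: "0 \<le> ?S n h $ v" for v by (rule S_nonneg[OF that(1)])
        have "p u y * ?S n h $ u \<le> mixture p (?S n h) y" by (rule component_le_mixture) (use py f in auto)
        moreover have "0 \<le> mixture p (?S n h) y" by (rule mixture_nonneg) (use py f in auto)
        moreover have "0 \<le> p u y * ?S n h $ u" using py f by simp
        ultimately have r: "0 \<le> p u y * ?S n h $ u / mixture p (?S n h) y"
          "p u y * ?S n h $ u / mixture p (?S n h) y \<le> 1"
          by (auto intro!: divide_le_eq_1[THEN iffD2])
        have "\<bar>W * a\<bar> \<le> W" if "0 \<le> a" "a \<le> 1" "0 \<le> W" for a W :: real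
          using that mult_left_mono[of a 1 W] by (simp add: abs_mult)
        from this[OF r] show ?thesis by simp
      qed
      \<comment> \<open>This is where \<delta> \<le> (1 - \<epsilon>) / 2 is spent: the exponent
        \<open>2 * (1 - \<delta>)\<close> is at least \<open>1 + \<epsilon>\<close>.\<close>
      have "(w (Suc n) powr (1 - \<delta>))\<^sup>2 = w (Suc n) powr (2 * (1 - \<delta>))" for n
        using ws(1)[of n] by (simp add: powr_power mult.commute)
      then show "summable (\<lambda>n. (w (Suc n) powr (1 - \<delta>))\<^sup>2)" using powr_sum[OF \<delta>1(2)] by simp
    qed
    then show ?thesis by (simp only: S_restrict)
  qed
  have pos: "AE \<omega> in P. \<forall>n u. 0 < p u (Y (Suc n) \<omega>)"
    unfolding AE_all_countable
  proof
    fix n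
    have "distr P N (Y (Suc n)) = Q" by (rule distr) simp
    then have "AE y in distr P N (Y (Suc n)). \<forall>u. 0 < p u y" using p_pos by (rule ssubst)
    then have "AE \<omega> in P. \<forall>u. 0 < p u (Y (Suc n) \<omega>)" by (rule AE_distrD[rotated]) (rule Y, simp)
    then show "\<forall>u. AE \<omega> in P. 0 < p u (Y (Suc n) \<omega>)" unfolding AE_all_countable .
  qed
  have noise_all: "AE \<omega> in P. \<forall>u. summable (\<lambda>n. w (Suc n) powr (1 - \<delta>) *
        (p u (Y (Suc n) \<omega>) * ?S n (\<lambda>i. Y i \<omega>) $ u / mixture p (?S n (\<lambda>i. Y i \<omega>)) (Y (Suc n) \<omega>))
      - (\<integral>y. w (Suc n) powr (1 - \<delta>) *
        (p u y * ?S n (\<lambda>i. Y i \<omega>) $ u / mixture p (?S n (\<lambda>i. Y i \<omega>)) y) \<partial>Q))"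
    unfolding AE_all_countable using noise by blast
  obtain \<rho> c C where \<rho>: "0 < \<rho>" and c: "0 < c"
    and drift_inner: "\<And>f. f \<in> prob_simplex \<Longrightarrow> norm (f - fs) < \<rho> \<Longrightarrow>
      inner (rescale (f - fs)) (rescale (drift f)) \<le> - c * (norm (rescale (f - fs)))\<^sup>2"
    and drift_norm: "\<And>f. f \<in> prob_simplex \<Longrightarrow> norm (f - fs) < \<rho> \<Longrightarrow>
      norm (rescale (drift f)) \<le> C * norm (rescale (f - fs))"
    by (rule local_drift_rescaled) blast
  show ?thesis
    using pos gain noise_all
  proof eventually_elim
    case (elim \<omega>)
    define y where "y i = Y i \<omega>" for i
    define f where "f n = pred_rec p w f0 y n" for n
    have S_f: "?S n (\<lambda>i. Y i \<omega>) = f n" for n by (simp add: f_def y_def[abs_def])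
    have py: "0 < p u (y i)" if "1 \<le> i" for i u
      using elim(1) that by (cases i) (auto simp: y_def)
    have f: "f n \<in> prob_simplex" "0 < f n $ u" for n u
      using pred_rec_in_simplex[of p y w f0 n] py weights f0 by (auto simp: f_def)
    have f_Suc: "f (Suc n) = pr_step p (w (Suc n)) (f n) (y (Suc n))" for n
      unfolding f_def by (rule pred_rec_Suc)
    define g where "g n = log_gain B (w (Suc n)) (f n) (y (Suc n))
      - (\<integral>y. log_gain B (w (Suc n)) (f n) y \<partial>Q)" for n
    have g: "summable g" using elim(2) by (simp add: S_f g_def[abs_def] y_def)
    define K where "K = B\<^sup>2 / (1 - b)"
    have "f \<longlonglongrightarrow> fs"
    \<comment> \<open>The perturbation consists of the second-order remainder of the logarithm and
      minus the centred gain; both series converge on this path.\<close>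
    proof (rule tendsto_minimizer[OF f _ w_div \<kappa>])
      show "summable (\<lambda>n. (w (Suc n))\<^sup>2 * K - g n)"
        by (intro summable_diff summable_mult2 sq_sum g)
      fix n
      show "0 \<le> w (Suc n)" using ws(1)[of n] by simp
      have "rel_entropy fs (f (Suc n)) \<le> rel_entropy fs (f n) - log_gain B (w (Suc n)) (f n) (y (Suc n))"
        unfolding f_Suc by (rule rel_entropy_pr_step[OF f]) (use py ws B in auto)
      moreover have "w (Suc n) * (min (excess (f n)) \<kappa> / 2) - (w (Suc n))\<^sup>2 * K
          \<le> (\<integral>y. log_gain B (w (Suc n)) (f n) y \<partial>Q)"
        unfolding K_def
        by (rule integral_log_gain_ge[OF f(1) _ b(2) b(1) B trunc[OF f(1)]]) (use ws(1)[of n] in simp)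
      ultimately show "rel_entropy fs (f (Suc n)) \<le> rel_entropy fs (f n) -
          w (Suc n) * (min (excess (f n)) \<kappa> / 2) + ((w (Suc n))\<^sup>2 * K - g n)"
        by (simp add: g_def)
    qed
    then have near: "\<forall>\<^sub>F n in sequentially. norm (f n - fs) < \<rho>"
      using \<rho> by (auto dest: tendstoD simp: dist_norm)
    define r where "r n u x = p u x * f n $ u / mixture p (f n) x" for n u x
    \<comment> \<open>\<open>r n u x\<close> is the posterior weight of u after observing x, and
      \<zeta> is its rescaled deviation from the conditional mean.\<close>
    define \<zeta> where "\<zeta> n = rescale (\<chi> u. r n u (y (Suc n)) - (\<integral>x. r n u x \<partial>Q))" for n
    have drift_eq: "drift (f n) $ u = (\<integral>x. r n u x \<partial>Q) - f n $ u" for n u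
    proof -
      have "(\<integral>x. r n u x \<partial>Q) = (\<integral>x. f n $ u * (p u x / mixture p (f n) x) \<partial>Q)"
        by (simp add: r_def mult.commute)
      also have "\<dots> = f n $ u * (\<integral>x. p u x / mixture p (f n) x \<partial>Q)" by (rule integral_mult_right_zero)
      finally show ?thesis by (simp add: drift_def right_diff_distrib)
    qed
    have rec: "rescale (f (Suc n) - fs) =
        rescale (f n - fs) + w (Suc n) *\<^sub>R (rescale (drift (f n)) + \<zeta> n)" for n
    proof (subst vec_eq_iff, rule allI)
      fix u
      have eq: "f (Suc n) $ u - fs $ u = (f n $ u - fs $ u) + w (Suc n) *
          (drift (f n) $ u + (r n u (y (Suc n)) - (\<integral>x. r n u x \<partial>Q)))"
        by (simp add: drift_eq f_Suc pr_step_def r_def algebra_simps)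
      have "(f (Suc n) $ u - fs $ u) / sqrt (fs $ u) = (f n $ u - fs $ u) / sqrt (fs $ u) + w (Suc n) *
          (drift (f n) $ u / sqrt (fs $ u) + (r n u (y (Suc n)) - (\<integral>x. r n u x \<partial>Q)) / sqrt (fs $ u))"
        unfolding eq by (simp only: add_divide_distrib times_divide_eq_right[symmetric])
      then show "rescale (f (Suc n) - fs) $ u =
          (rescale (f n - fs) + w (Suc n) *\<^sub>R (rescale (drift (f n)) + \<zeta> n)) $ u"
        by (simp only: rescale_def \<zeta>_def vec_lambda_beta vector_minus_component
            vector_add_component vector_scaleR_component real_scaleR_def)
    qed
    have noise_sum: "summable (\<lambda>n. w (Suc n) powr (1 - \<delta>) *\<^sub>R \<zeta> n)"
    proof -
      have comp: "summable (\<lambda>n. w (Suc n) powr (1 - \<delta>) * \<zeta> n $ u)" for u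
      proof -
        have "summable (\<lambda>n. w (Suc n) powr (1 - \<delta>) * r n u (y (Suc n))
            - (\<integral>x. w (Suc n) powr (1 - \<delta>) * r n u x \<partial>Q))"
          using elim(3) unfolding S_f r_def y_def by blast
        then have "summable (\<lambda>n. (w (Suc n) powr (1 - \<delta>) * r n u (y (Suc n))
            - (\<integral>x. w (Suc n) powr (1 - \<delta>) * r n u x \<partial>Q)) * (1 / sqrt (fs $ u)))"
          by (rule summable_mult2)
        then show ?thesis by (simp add: \<zeta>_def rescale_def right_diff_distrib)
      qed
      \<comment> \<open>Expansion along the coordinate axes reduces vector summability to the scalar
        series.\<close>
      have "w (Suc n) powr (1 - \<delta>) *\<^sub>R \<zeta> n =
          (\<Sum>u\<in>UNIV. (w (Suc n) powr (1 - \<delta>) * \<zeta> n $ u) *\<^sub>R axis u 1)" for n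
        by (simp add: vec_eq_iff axis_def if_distrib cong: if_cong)
      then show ?thesis
        by (simp only:) (intro summable_sum bounded_linear.summable[OF bounded_linear_scaleR_left] comp)
    qed
    have lim: "(\<lambda>n. norm (rescale (f n - fs)) / w n powr \<delta>) \<longlonglongrightarrow> 0"
    proof (rule stochastic_approximation_rate[OF ws(1) w0 w_div w_inv _ _ rec noise_sum c])
      show "\<forall>\<^sub>F n in sequentially. inner (rescale (f n - fs)) (rescale (drift (f n)))
          \<le> - c * (norm (rescale (f n - fs)))\<^sup>2"
        using near by eventually_elim (rule drift_inner[OF f(1)])
      show "\<forall>\<^sub>F n in sequentially. norm (rescale (drift (f n))) \<le> C * norm (rescale (f n - fs))"
        using near by eventually_elim (rule drift_norm[OF f(1)])
    qed (use \<delta> \<delta>1 in auto)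
    have "(\<lambda>n. norm (f n - fs) / w n powr \<delta>) \<longlonglongrightarrow> 0"
    proof (rule tendsto_sandwich[OF _ _ tendsto_const lim])
      show "\<forall>\<^sub>F n in sequentially. norm (f n - fs) / w n powr \<delta> \<le> norm (rescale (f n - fs)) / w n powr \<delta>"
        by (intro always_eventually allI divide_right_mono norm_le_rescale) simp
    qed simp
    moreover have "\<forall>\<^sub>F n in sequentially. w n powr \<delta> \<noteq> 0"
      using weights by (intro eventually_sequentiallyI[of 1]) force
    ultimately show ?case
      unfolding f_def y_def by (intro smalloI_tendsto) auto
  qed
qed

end

section \<open>Divergences between densities as integrals against the data law\<close>

lemma prob_density_mixture:
  assumes p: "\<And>u. prob_density N (p u)" and f: "f \<in> prob_simplex"
  shows "prob_density N (mixture p f)"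
  unfolding prob_density_def
proof (intro conjI ballI)
  have [measurable]: "p u \<in> borel_measurable N" for u using p by (simp add: prob_density_def)
  have p0: "0 \<le> p u y" if "y \<in> space N" for u y using p[of u] that by (simp add: prob_density_def)
  note f0 = prob_simplexD(1)[OF f]
  show "mixture p f \<in> borel_measurable N" by measurable
  show "0 \<le> mixture p f y" if "y \<in> space N" for y
    by (rule mixture_nonneg) (use p0 that f0 in auto)
  have "(\<integral>\<^sup>+ y. ennreal (mixture p f y) \<partial>N) = (\<integral>\<^sup>+ y. (\<Sum>u\<in>UNIV. ennreal (f $ u) * ennreal (p u y)) \<partial>N)"
  proof (rule nn_integral_cong)
    fix y assume "y \<in> space N"
    then show "ennreal (mixture p f y) = (\<Sum>u\<in>UNIV. ennreal (f $ u) * ennreal (p u y))"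
      using p0 f0 by (simp add: mixture_def sum_ennreal mult.commute flip: ennreal_mult)
  qed
  also have "\<dots> = (\<Sum>u\<in>UNIV. ennreal (f $ u) * (\<integral>\<^sup>+ y. ennreal (p u y) \<partial>N))"
    by (simp add: nn_integral_sum nn_integral_cmult)
  also have "\<dots> = 1"
    using p prob_simplexD(2)[OF f] f0 by (simp add: prob_density_def sum_ennreal)
  finally show "(\<integral>\<^sup>+ y. ennreal (mixture p f y) \<partial>N) = 1" .
qed

text \<open>The negative part is always at most 1, so a finite divergence has a finite positive
  part. Hence h cannot vanish on a set charged by g, the extended-real integrand is real almost
  everywhere, and its integral becomes one against the law with density g.\<close>

lemma KL_finite:
  assumes g: "prob_density N g" and h: "prob_density N h" and fin: "KL N g h < \<infinity>"
  shows "AE y in density N g. 0 < g y \<and> 0 < h y"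
    and "integrable (density N g) (\<lambda>y. ln (g y / h y))"
    and "KL N g h = ereal (\<integral>y. ln (g y / h y) \<partial>density N g)"
proof -
  have [measurable]: "g \<in> borel_measurable N" "h \<in> borel_measurable N"
    using g h by (auto simp: prob_density_def)
  have AE_nn: "AE y in N. 0 \<le> g y" "AE y in N. 0 \<le> h y"
    using g h by (auto simp: prob_density_def)
  let ?P = "\<integral>\<^sup>+ y. e2ennreal (KL_integrand (g y) (h y)) \<partial>N"
  let ?M = "\<integral>\<^sup>+ y. e2ennreal (- KL_integrand (g y) (h y)) \<partial>N"
  let ?k = "\<lambda>y. g y * ln (g y / h y)"
  obtain q where q: "?M = ennreal q" "0 \<le> q"
    using KL_neg_part_le[OF g h] by (cases ?M) (auto simp: top_unique)
  obtain r where r: "?P = ennreal r" "0 \<le> r"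
    using fin q by (cases ?P) (auto simp: KL_def enn2ereal_ennreal)
  have [measurable]: "(\<lambda>y. KL_integrand (g y) (h y)) \<in> borel_measurable N"
    unfolding KL_integrand_def by measurable
  have "AE y in N. e2ennreal (KL_integrand (g y) (h y)) \<noteq> \<infinity>"
    using r by (intro nn_integral_PInf_AE) auto
  then have ac: "AE y in N. h y = 0 \<longrightarrow> g y = 0"
    by eventually_elim (auto simp: KL_integrand_def split: if_splits)
  have eq: "AE y in N. KL_integrand (g y) (h y) = ereal (?k y)"
    using ac by eventually_elim (auto simp: KL_integrand_def split: if_splits)
  have P: "?P = (\<integral>\<^sup>+ y. ennreal (?k y) \<partial>N)"
    by (rule nn_integral_cong_AE, use eq in eventually_elim) simp
  have M: "?M = (\<integral>\<^sup>+ y. ennreal (- ?k y) \<partial>N)"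
    by (rule nn_integral_cong_AE, use eq in eventually_elim) simp
  have int: "integrable N ?k"
    using r q unfolding P M real_integrable_def by auto
  show "AE y in density N g. 0 < g y \<and> 0 < h y"
    using ac AE_nn by (subst AE_density) (auto simp: less_le elim: eventually_elim2)
  show "integrable (density N g) (\<lambda>y. ln (g y / h y))"
    using int AE_nn(1) by (subst integrable_density) (auto simp: less_le)
  have "(\<integral>y. ln (g y / h y) \<partial>density N g) = (\<integral>y. ?k y \<partial>N)"
    using AE_nn(1) by (subst integral_density) auto
  also have "\<dots> = r - q"
    unfolding real_lebesgue_integral_def[OF int] P[symmetric] M[symmetric] r(1) q(1)
    using r(2) q(2) by simp
  finally show "KL N g h = ereal (\<integral>y. ln (g y / h y) \<partial>density N g)"
    unfolding KL_def r(1) q(1) using r(2) q(2) by (simp add: enn2ereal_ennreal)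
qed

lemma axis_in_prob_simplex: "axis u 1 \<in> prob_simplex"
  by (simp add: prob_simplex_def axis_def)

text \<open>The vertices of the simplex are mixing densities too: finite divergence there makes
  every \<open>p u\<close> positive under the data law and every logarithm integrable. Subtracting
  the divergence at \<open>fs\<close> cancels m.\<close>

lemma interior_KL_minimizer_density:
  fixes p :: "'u::finite \<Rightarrow> 'y \<Rightarrow> real"
  assumes p: "\<And>u. prob_density N (p u)" and m: "prob_density N m"
    and fin: "\<And>f. f \<in> prob_simplex \<Longrightarrow> KL N m (mixture p f) < \<infinity>"
    and min: "is_arg_min (\<lambda>f. KL N m (mixture p f)) (\<lambda>f. f \<in> prob_simplex) fs"
    and unique: "\<And>f. is_arg_min (\<lambda>f. KL N m (mixture p f)) (\<lambda>f. f \<in> prob_simplex) f \<Longrightarrow> f = fs"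
    and pos: "\<And>u. 0 < fs $ u"
  shows "interior_KL_minimizer (density N m) p fs"
proof -
  let ?Q = "density N m"
  have m_meas [measurable]: "m \<in> borel_measurable N" using m by (simp add: prob_density_def)
  have p_meas [measurable]: "p u \<in> borel_measurable N" for u using p by (simp add: prob_density_def)
  have fs: "fs \<in> prob_simplex" using min by (simp add: is_arg_min_def)
  note K = KL_finite[OF m prob_density_mixture[OF p] fin]
  have pos_f: "AE y in ?Q. 0 < m y \<and> 0 < mixture p f y" if "f \<in> prob_simplex" for f
    using K(1)[OF that that] .
  have diff: "AE y in ?Q. ln (mixture p fs y / mixture p f y) =
      ln (m y / mixture p f y) - ln (m y / mixture p fs y)" if "f \<in> prob_simplex" for f
    using pos_f[OF fs] pos_f[OF that] by eventually_elim (simp add: ln_div)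
  have int: "integrable ?Q (\<lambda>y. ln (mixture p fs y / mixture p f y))"
    and val: "(\<integral>y. ln (mixture p fs y / mixture p f y) \<partial>?Q) =
      (\<integral>y. ln (m y / mixture p f y) \<partial>?Q) - (\<integral>y. ln (m y / mixture p fs y) \<partial>?Q)"
    if f: "f \<in> prob_simplex" for f
  proof -
    have i: "integrable ?Q (\<lambda>y. ln (m y / mixture p f y) - ln (m y / mixture p fs y))"
      using K(2)[OF f f] K(2)[OF fs fs] by simp
    show "integrable ?Q (\<lambda>y. ln (mixture p fs y / mixture p f y))"
      using i by (rule integrable_cong_AE_imp) (use diff[OF f] in \<open>auto simp: eq_commute\<close>)
    have "(\<integral>y. ln (mixture p fs y / mixture p f y) \<partial>?Q) =
        (\<integral>y. ln (m y / mixture p f y) - ln (m y / mixture p fs y) \<partial>?Q)"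
      by (rule integral_cong_AE) (use diff[OF f] in auto)
    then show "(\<integral>y. ln (mixture p fs y / mixture p f y) \<partial>?Q) =
      (\<integral>y. ln (m y / mixture p f y) \<partial>?Q) - (\<integral>y. ln (m y / mixture p fs y) \<partial>?Q)"
      using K(2)[OF f f] K(2)[OF fs fs] by simp
  qed
  have mix_axis: "mixture p (axis u 1) = p u" for u by (rule ext) (rule mixture_axis)
  interpret prob_space ?Q
    by (rule prob_spaceI) (use m in \<open>simp add: prob_density_def emeasure_density nn_set_integral_space\<close>)
  show ?thesis
  proof
    show "p u \<in> borel_measurable ?Q" for u by simp
    show "0 \<le> p u y" if "y \<in> space ?Q" for u y using p[of u] that by (simp add: prob_density_def)
    have "AE y in ?Q. 0 < p u y" for u
      using pos_f[OF axis_in_prob_simplex[of u]] by eventually_elim (simp add: mix_axis)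
    then show "AE y in ?Q. \<forall>u. 0 < p u y" by (simp add: AE_all_countable)
    show "integrable ?Q (\<lambda>y. ln (mixture p fs y / p u y))" for u
      using int[OF axis_in_prob_simplex[of u]] by (simp add: mix_axis)
    show "0 < (\<integral>y. ln (mixture p fs y / mixture p f y) \<partial>?Q)" if f: "f \<in> prob_simplex" "f \<noteq> fs" for f
    proof (rule ccontr)
      \<comment> \<open>With a nonpositive integral f would do at least as well as \<open>fs\<close>
        and be a second minimizer.\<close>
      assume "\<not> ?thesis"
      then have "KL N m (mixture p f) \<le> KL N m (mixture p fs)"
        using val[OF f(1)] by (simp add: K(3)[OF f(1) f(1)] K(3)[OF fs fs])
      then have "is_arg_min (\<lambda>f. KL N m (mixture p f)) (\<lambda>f. f \<in> prob_simplex) f"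
        using min f(1) by (auto simp: is_arg_min_def intro: le_less_trans less_le_trans)
      then show False using unique f(2) by blast
    qed
  qed (use fs pos in auto)
qed

theorem theorem2:
  fixes P :: "'w measure" and N :: "'y measure"
    and T :: "'u::finite topology"
    and p :: "'u \<Rightarrow> 'y \<Rightarrow> real" and m :: "'y \<Rightarrow> real"
    and Y :: "nat \<Rightarrow> 'w \<Rightarrow> 'y"
    and w :: "nat \<Rightarrow> real" and f0 fstar :: "real ^ 'u"
    and \<epsilon> \<delta> :: real
  assumes "prob_space P"
    and kernel: "\<And>u. prob_density N (p u)"
    and true_density: "prob_density N m"
    and data_distr: "\<And>i. i \<ge> 1 \<Longrightarrow> distributed P N (Y i) (\<lambda>y. ennreal (m y))"
    and data_indep: "prob_space.indep_vars P (\<lambda>_. N) Y {1..}"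
    and weights: "\<And>n. n \<ge> 1 \<Longrightarrow> 0 < w n \<and> w n < 1"
    and init: "f0 \<in> prob_simplex" and init_pos: "\<And>u. 0 < f0 $ u"
    and topology: "topspace T = UNIV"
    and A1: "\<And>y. y \<in> space N \<Longrightarrow> continuous_map T euclideanreal (\<lambda>u. p u y)"
    and A2: "inj_on (\<lambda>f. restrict (mixture p f) (space N)) prob_simplex"
    and eps: "0 < \<epsilon>" "\<epsilon> \<le> 1"
    and A3_div: "\<not> summable (\<lambda>n. w (Suc n))"
    and A3_sum: "summable (\<lambda>n. w (Suc n) powr (1 + \<epsilon>))"
    and A4: "(\<lambda>n. inverse (w (Suc n)) - inverse (w n)) \<longlonglongrightarrow> 0"
    and A5_finite: "\<And>f. f \<in> prob_simplex \<Longrightarrow> KL N m (mixture p f) < \<infinity>"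
    and A5_min: "is_arg_min (\<lambda>f. KL N m (mixture p f)) (\<lambda>f. f \<in> prob_simplex) fstar"
    and A5_unique: "\<And>f. is_arg_min (\<lambda>f. KL N m (mixture p f)) (\<lambda>f. f \<in> prob_simplex) f
                      \<Longrightarrow> f = fstar"
    and A5_interior: "\<And>u. 0 < fstar $ u"
    and delta: "0 < \<delta>" "\<delta> \<le> (1 - \<epsilon>) / 2"
  shows "AE \<omega> in P. (\<lambda>n. norm (pred_rec p w f0 (\<lambda>i. Y i \<omega>) n - fstar)) \<in> o(\<lambda>n. w n powr \<delta>)"
proof -
  interpret interior_KL_minimizer "density N (\<lambda>y. ennreal (m y))" p fstar
    by (rule interior_KL_minimizer_density[OF kernel true_density A5_finite A5_min A5_unique A5_interior])
  show ?thesis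
  proof (rule pred_rec_rate[OF assms(1) _ data_indep _ weights init init_pos eps(1) A3_div A3_sum A4 delta])
    show "distr P N (Y i) = density N (\<lambda>y. ennreal (m y))" if "i \<ge> 1" for i
      using data_distr[OF that] by (rule distributed_distr_eq_density)
  qed simp
qed

end
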